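(* Let $(f_i: G_i \to H_i)_{i\in I}$ be a family of continuous homomorphisms of topological groups such that every $H_i$ is Hausdorff, and let $\prod_{i\in I} f_i : \prod_{i\in I} G_i \to \prod_{i\in I} H_i$ be their product (with product topologies). (a) If every $f_i$ is c-proper, then $\prod_{i\in I} f_i$ is c-proper. (b) If every $f_i$ is c-perfect, then $\prod_{i\in I} f_i$ is c-perfect. (c) If every $f_i$ is h-complete, then $\prod_{i\in I} f_i$ is h-complete.
   Context: Topological groups are not assumed to be Hausdorff unless stated. A continuous homomorphism $f:G\to H$ is c-closed if $f(A)$ is closed in $H$ for every closed subgroup $A\le G$. It is c-proper if for every topological group $K$ and every continuous homomorphism $g:K\to H$, the projection $p_2: G\times_H K=\{(x,y)\in G\times K : f(x)=g(y)\}\to K$ is c-closed. A continuous homomorphism $f:G\to H$ is (fibrewise) Hausdorff if any two distinct points of the same fibre of $f$ can be separated by disjoint open neighbourhoods in $G$. It is c-perfect if it is c-proper and Hausdorff. A continuous homomorphism $f:G\to H$ is h-complete if for every topological group $K$ and every factorization $f=k\cdot h$ into continuous homomorphisms $h:G\to K$, $k:K\to H$ with $k$ Hausdorff, the image $h(G)$ is closed in $K$. *)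

theory Defs
  imports "HOL-Analysis.Analysis" "HOL-Algebra.Algebra"
begin

text \<open>No separation axiom is imposed on the topology.\<close>

definition topological_group :: "'a monoid \<Rightarrow> 'a topology \<Rightarrow> bool" where
  "topological_group G S \<longleftrightarrow>
     group G \<and> topspace S = carrier G \<and>
     continuous_map (prod_topology S S) S (\<lambda>(x, y). x \<otimes>\<^bsub>G\<^esub> y) \<and>
     continuous_map S S (\<lambda>x. inv\<^bsub>G\<^esub> x)"

definition continuous_hom ::
  "'a monoid \<Rightarrow> 'a topology \<Rightarrow> 'b monoid \<Rightarrow> 'b topology \<Rightarrow> ('a \<Rightarrow> 'b) \<Rightarrow> bool" where
  "continuous_hom G S H T f \<longleftrightarrow> f \<in> hom G H \<and> continuous_map S T f"

definition c_closed :: "'a monoid \<Rightarrow> 'a topology \<Rightarrow> 'b topology \<Rightarrow> ('a \<Rightarrow> 'b) \<Rightarrow> bool" where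
  "c_closed G S T f \<longleftrightarrow> (\<forall>A. subgroup A G \<and> closedin S A \<longrightarrow> closedin T (f ` A))"

definition pullback_carrier ::
  "'a monoid \<Rightarrow> 'k monoid \<Rightarrow> ('a \<Rightarrow> 'b) \<Rightarrow> ('k \<Rightarrow> 'b) \<Rightarrow> ('a \<times> 'k) set" where
  "pullback_carrier G K f g = {(x, y). x \<in> carrier G \<and> y \<in> carrier K \<and> f x = g y}"

definition pullback_group ::
  "'a monoid \<Rightarrow> 'k monoid \<Rightarrow> ('a \<Rightarrow> 'b) \<Rightarrow> ('k \<Rightarrow> 'b) \<Rightarrow> ('a \<times> 'k) monoid" where
  "pullback_group G K f g = (G \<times>\<times> K)\<lparr>carrier := pullback_carrier G K f g\<rparr>"

definition pullback_topology ::
  "'a monoid \<Rightarrow> 'a topology \<Rightarrow> 'k monoid \<Rightarrow> 'k topology \<Rightarrow> ('a \<Rightarrow> 'b) \<Rightarrow> ('k \<Rightarrow> 'b)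
     \<Rightarrow> ('a \<times> 'k) topology" where
  "pullback_topology G S K U f g = subtopology (prod_topology S U) (pullback_carrier G K f g)"

text \<open>The notions \<open>c_proper\<close>, \<open>c_perfect\<close> and \<open>h_complete\<close> quantify over all topological groups.
  HOL cannot quantify over types inside a formula, so these predicates carry a type argument
  \<open>TYPE('k)\<close>, and the test groups \<open>K\<close> range over all topological groups whose carrier is a subset
  of the type \<open>'k\<close>. The unrestricted notion is the predicate for every \<open>'k\<close>.\<close>

definition c_proper ::
  "'k itself \<Rightarrow> 'a monoid \<Rightarrow> 'a topology \<Rightarrow> 'b monoid \<Rightarrow> 'b topology \<Rightarrow> ('a \<Rightarrow> 'b) \<Rightarrow> bool" where
  "c_proper _ G S H T f \<longleftrightarrow>
     (\<forall>(K :: 'k monoid) U g. topological_group K U \<and> continuous_hom K U H T g \<longrightarrow>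
        c_closed (pullback_group G K f g) (pullback_topology G S K U f g) U snd)"

definition fibrewise_Hausdorff :: "'a topology \<Rightarrow> ('a \<Rightarrow> 'b) \<Rightarrow> bool" where
  "fibrewise_Hausdorff S f \<longleftrightarrow>
     (\<forall>x\<in>topspace S. \<forall>y\<in>topspace S. x \<noteq> y \<and> f x = f y \<longrightarrow>
        (\<exists>V W. openin S V \<and> openin S W \<and> x \<in> V \<and> y \<in> W \<and> disjnt V W))"

definition c_perfect ::
  "'k itself \<Rightarrow> 'a monoid \<Rightarrow> 'a topology \<Rightarrow> 'b monoid \<Rightarrow> 'b topology \<Rightarrow> ('a \<Rightarrow> 'b) \<Rightarrow> bool" where
  "c_perfect k G S H T f \<longleftrightarrow> c_proper k G S H T f \<and> fibrewise_Hausdorff S f"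

definition h_complete ::
  "'k itself \<Rightarrow> 'a monoid \<Rightarrow> 'a topology \<Rightarrow> 'b monoid \<Rightarrow> 'b topology \<Rightarrow> ('a \<Rightarrow> 'b) \<Rightarrow> bool" where
  "h_complete _ G S H T f \<longleftrightarrow>
     (\<forall>(K :: 'k monoid) U h k.
        topological_group K U \<and> continuous_hom G S K U h \<and> continuous_hom K U H T k \<and>
        fibrewise_Hausdorff U k \<and> (\<forall>x\<in>carrier G. f x = k (h x)) \<longrightarrow>
        closedin U (h ` carrier G))"

definition product_map :: "'i set \<Rightarrow> ('i \<Rightarrow> 'a \<Rightarrow> 'b) \<Rightarrow> ('i \<Rightarrow> 'a) \<Rightarrow> 'i \<Rightarrow> 'b" where
  "product_map I f x = (\<lambda>i\<in>I. f i (x i))"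

end

theory Submission
  imports Defs
begin

text \<open>
  All three parts extend a compatible choice of coordinates one index at a time; Zorn's lemma
  applies because the conditions involved are closure conditions in a product, hence of finite
  character.

  For c-properness let \<open>A\<close> be a closed subgroup of the pullback \<open>P\<close> of \<open>K\<close> along \<open>\<Prod>f\<^sub>i\<close> and let
  \<open>y\<close> lie in the closure of its projection to \<open>K\<close>. For \<open>J \<subseteq> I\<close> let \<open>P\<^sub>J \<supseteq> P\<close> be the group obtained
  by imposing only the equations with index in \<open>J\<close>, and let \<open>A\<^sub>J\<close> be the closure in \<open>P\<^sub>J\<close> of the
  subgroup of all elements that agree with an element of \<open>A\<close> on the coordinates in \<open>J\<close> and on \<open>K\<close>.
  As \<open>f\<^sub>i\<close> is c-proper, the image of (a copy of) \<open>A\<^bsub>J\<union>{i}\<^esub>\<close> in \<open>P\<^sub>J\<close> is closed, so every point of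
  \<open>A\<^sub>J\<close> can be moved into \<open>A\<^bsub>J\<union>{i}\<^esub>\<close> by changing its \<open>i\<close>-th coordinate. One starts from a point
  over \<open>y\<close> in \<open>A\<^bsub>{}\<^esub>\<close>, and \<open>A\<^sub>I = A\<close>.

  For h-completeness let \<open>h : \<Prod>G\<^sub>i \<rightarrow> K\<close> and let \<open>y\<close> lie in the closure of its image. Let \<open>M\<^sub>J\<close> be
  the closure of the image under \<open>h\<close> of the elements that are trivial on \<open>J\<close>. Since \<open>H\<^sub>i\<close> is Hausdorff,
  \<open>K \<rightarrow> H\<^sub>i\<close> is trivial on \<open>M\<^bsub>J\<union>{i}\<^esub>\<close>, so h-completeness of \<open>f\<^sub>i\<close> applies to the Hausdorff quotient
  \<open>M\<^sub>J / M\<^bsub>J\<union>{i}\<^esub>\<close>, in which \<open>G\<^sub>i\<close> has dense image; hence \<open>M\<^sub>J = M\<^bsub>J\<union>{i}\<^esub> h(G\<^sub>i)\<close>. This allows one to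
  extend \<open>x\<close> with \<open>y \<in> M\<^sub>J h(x)\<close> coordinatewise.
\<close>

no_notation eq_closure_of (\<open>closure'_of\<index>\<close>)

section \<open>Zorn's lemma for choices of coordinates\<close>

text \<open>By \<open>mono\<close> and \<open>fin\<close>, \<open>Q J x\<close> depends only on the
  values of \<open>x\<close> on \<open>J\<close>, so a pair \<open>(J, x)\<close> may be treated as
  a partial function with domain \<open>J\<close>. Condition \<open>fin\<close> bounds chains of
  such partial functions, and \<open>ext\<close> forces a maximal one to be defined on all of
  \<open>I\<close>.\<close>

lemma finite_character_selection:
  assumes start: "x0 \<in> PiE I B" "Q {} x0"
    and mono: "\<And>J F x. Q J x \<Longrightarrow> F \<subseteq> J \<Longrightarrow> Q F x"
    and fin: "\<And>J x. J \<subseteq> I \<Longrightarrow> x \<in> PiE I B \<Longrightarrow>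
        (\<And>F. finite F \<Longrightarrow> F \<subseteq> J \<Longrightarrow> \<exists>x'\<in>PiE I B. (\<forall>j\<in>F. x' j = x j) \<and> Q F x') \<Longrightarrow> Q J x"
    and ext: "\<And>J x i. J \<subseteq> I \<Longrightarrow> x \<in> PiE I B \<Longrightarrow> Q J x \<Longrightarrow> i \<in> I - J \<Longrightarrow>
        \<exists>t\<in>B i. Q (insert i J) (x(i := t))"
  shows "\<exists>x\<in>PiE I B. Q I x"
proof -
  \<comment> \<open>Partial functions are encoded by their graphs, so that extension becomes
    inclusion and the subset form of Zorn's lemma applies.\<close>
  define graph where "graph J x = (\<lambda>j. (j, x j)) ` J" for J and x :: "'a \<Rightarrow> 'b"
  define \<A> where "\<A> = {graph J x |J x. J \<subseteq> I \<and> x \<in> PiE I B \<and> Q J x}"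
  have "graph {} x0 \<in> \<A>"
    using start by (auto simp: \<A>_def)
  then have "\<A> \<noteq> {}"
    by blast
  moreover have "\<Union>\<C> \<in> \<A>" if "\<C> \<noteq> {}" and chain: "subset.chain \<A> \<C>" for \<C>
  proof -
    \<comment> \<open>In a chain, finitely many points of the union already lie in one member.
      Single-valuedness, membership in \<open>B\<close> and the premise of \<open>fin\<close> all
      follow from this.\<close>
    have piece: "\<exists>J x. J \<subseteq> I \<and> x \<in> PiE I B \<and> Q J x \<and> D \<subseteq> graph J x \<and> graph J x \<in> \<C>"
      if D: "finite D" "D \<subseteq> \<Union>\<C>" for D
    proof -
      obtain R where R: "R \<in> \<C>" "D \<subseteq> R"
        using finite_subset_Union_chain[OF D \<open>\<C> \<noteq> {}\<close> chain] by blast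
      then have "R \<in> \<A>"
        using chain by (auto simp: subset.chain_def)
      then show ?thesis
        using R by (auto simp: \<A>_def)
    qed
    define J where "J = fst ` \<Union>\<C>"
    \<comment> \<open>Outside \<open>J\<close> the starting point \<open>x0\<close> fills in values,
      only to obtain a total element of \<open>PiE I B\<close>.\<close>
    define x where "x = (\<lambda>i\<in>I. if i \<in> J then SOME t. (i, t) \<in> \<Union>\<C> else x0 i)"
    have J: "J \<subseteq> I"
    proof
      fix i assume "i \<in> J"
      then obtain t where "(i, t) \<in> \<Union>\<C>"
        unfolding J_def by force
      then show "i \<in> I"
        using piece[of "{(i, t)}"] by (auto simp: graph_def)
    qed
    have xD: "(i, x i) \<in> \<Union>\<C>" if "i \<in> J" for i
    proof -
      have "\<exists>t. (i, t) \<in> \<Union>\<C>"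
        using that unfolding J_def by force
      then have "(i, SOME t. (i, t) \<in> \<Union>\<C>) \<in> \<Union>\<C>"
        by (rule someI_ex)
      then show ?thesis
        using that J by (simp add: x_def subset_iff)
    qed
    have uniq: "t = t'" if "(i, t) \<in> \<Union>\<C>" "(i, t') \<in> \<Union>\<C>" for i t t'
      using piece[of "{(i, t), (i, t')}"] that by (auto simp: graph_def)
    have "x \<in> PiE I B"
    proof (rule PiE_I)
      fix i assume "i \<in> I"
      show "x i \<in> B i"
      proof (cases "i \<in> J")
        case True
        then show ?thesis
          using piece[of "{(i, x i)}"] xD by (auto simp: graph_def PiE_iff)
      next
        case False
        then show ?thesis
          using \<open>i \<in> I\<close> start(1) by (auto simp: x_def)
      qed
    qed (simp add: x_def)
    moreover have "Q J x"
    proof (rule fin[OF J \<open>x \<in> PiE I B\<close>])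
      fix F assume F: "finite F" "F \<subseteq> J"
      then have "graph F x \<subseteq> \<Union>\<C>"
        using xD by (auto simp: graph_def)
      moreover have "finite (graph F x)"
        using F by (simp add: graph_def)
      ultimately obtain J' x' where *: "x' \<in> PiE I B" "Q J' x'" "graph F x \<subseteq> graph J' x'"
        using piece by meson
      then have "F \<subseteq> J'" "\<forall>j\<in>F. x' j = x j"
        by (auto simp: graph_def)
      then show "\<exists>x'\<in>PiE I B. (\<forall>j\<in>F. x' j = x j) \<and> Q F x'"
        using * mono by blast
    qed
    moreover have "\<Union>\<C> = graph J x"
    proof -
      have "(i, t) \<in> \<Union>\<C> \<longleftrightarrow> (i, t) \<in> graph J x" for i t
      proof
        assume *: "(i, t) \<in> \<Union>\<C>"
        then have "i \<in> J"
          unfolding J_def by force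
        then show "(i, t) \<in> graph J x"
          using uniq[OF * xD] by (auto simp: graph_def)
      qed (use xD in \<open>auto simp: graph_def\<close>)
      then show ?thesis
        by (simp add: set_eq_iff split_paired_All)
    qed
    ultimately show ?thesis
      using J by (auto simp: \<A>_def)
  qed
  ultimately obtain M where "M \<in> \<A>" and max: "\<And>R. R \<in> \<A> \<Longrightarrow> M \<subseteq> R \<Longrightarrow> R = M"
    using subset_Zorn_nonempty[of \<A>] by metis
  then obtain J x where M: "M = graph J x" "J \<subseteq> I" "x \<in> PiE I B" "Q J x"
    by (auto simp: \<A>_def)
  have "i \<in> J" if "i \<in> I" for i
  proof (rule ccontr)
    assume "i \<notin> J"
    then obtain t where t: "t \<in> B i" "Q (insert i J) (x(i := t))"
      using ext M \<open>i \<in> I\<close> by blast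
    have "x(i := t) \<in> PiE I B"
      using M t \<open>i \<in> I\<close> by (auto simp: PiE_iff extensional_def)
    then have "graph (insert i J) (x(i := t)) \<in> \<A>"
      using M t \<open>i \<in> I\<close> by (auto simp: \<A>_def)
    moreover have "M \<subseteq> graph (insert i J) (x(i := t))"
      using \<open>i \<notin> J\<close> by (auto simp: M graph_def)
    ultimately have "graph (insert i J) (x(i := t)) = M"
      by (rule max)
    then show False
      using \<open>i \<notin> J\<close> by (auto simp: M graph_def)
  qed
  then have "J = I"
    using M by blast
  then show ?thesis
    using M by blast
qed

section \<open>Products and subgroups of topological groups\<close>

lemma topological_group_mult:
  assumes "topological_group G S" "continuous_map W S f" "continuous_map W S g"
  shows "continuous_map W S (\<lambda>x. f x \<otimes>\<^bsub>G\<^esub> g x)"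
proof -
  have "continuous_map W (prod_topology S S) (\<lambda>x. (f x, g x))"
    using assms by (intro continuous_intros)
  then have "continuous_map W S ((\<lambda>(x, y). x \<otimes>\<^bsub>G\<^esub> y) \<circ> (\<lambda>x. (f x, g x)))"
    using assms(1) unfolding topological_group_def by (blast intro: continuous_map_compose)
  then show ?thesis
    by (simp add: o_def)
qed

lemma topological_group_inv:
  assumes "topological_group G S" "continuous_map W S f"
  shows "continuous_map W S (\<lambda>x. inv\<^bsub>G\<^esub> f x)"
  using continuous_map_compose[OF assms(2), of S "\<lambda>x. inv\<^bsub>G\<^esub> x"] assms(1)
  by (simp add: topological_group_def o_def)

lemma topological_group_imp_group: "topological_group G S \<Longrightarrow> group G"
  and topological_group_topspace: "topological_group G S \<Longrightarrow> topspace S = carrier G"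
  by (simp_all add: topological_group_def)

lemma topological_group_product:
  assumes "\<And>i. i \<in> I \<Longrightarrow> topological_group (G i) (S i)"
  shows "topological_group (product_group I G) (product_topology S I)"
proof -
  have comp: "continuous_map W (S i) (\<lambda>x. f x i)"
    if "continuous_map W (product_topology S I) f" "i \<in> I" for W f i
    using that by (simp add: continuous_map_componentwise)
  have grp: "\<And>i. i \<in> I \<Longrightarrow> group (G i)"
    using assms topological_group_imp_group by blast
  have top: "topspace (product_topology S I) = carrier (product_group I G)"
    by (auto simp: assms[THEN topological_group_topspace] intro!: PiE_cong)
  have "continuous_map (prod_topology (product_topology S I) (product_topology S I))
      (product_topology S I) (\<lambda>p. \<lambda>i\<in>I. fst p i \<otimes>\<^bsub>G i\<^esub> snd p i)"
    unfolding continuous_map_componentwise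
    by (simp add: image_subset_iff topological_group_mult assms comp continuous_map_fst continuous_map_snd)
  moreover have "continuous_map (product_topology S I) (product_topology S I) (\<lambda>x. \<lambda>i\<in>I. inv\<^bsub>G i\<^esub> x i)"
    unfolding continuous_map_componentwise
    by (auto intro!: topological_group_inv assms continuous_map_product_projection)
  then have "continuous_map (product_topology S I) (product_topology S I) (\<lambda>x. inv\<^bsub>product_group I G\<^esub> x)"
    by (rule continuous_map_eq) (use top grp in simp)
  ultimately show ?thesis
    using grp top by (simp add: topological_group_def split_def)
qed

lemma topological_group_DirProd:
  assumes G: "topological_group G S" and K: "topological_group K U"
  shows "topological_group (G \<times>\<times> K) (prod_topology S U)"
proof -
  note grp = topological_group_imp_group[OF G] topological_group_imp_group[OF K]
  have top: "topspace (prod_topology S U) = carrier (G \<times>\<times> K)"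
    using assms by (simp add: topological_group_topspace)
  let ?P = "prod_topology (prod_topology S U) (prod_topology S U)"
  have p: "continuous_map ?P S (\<lambda>p. fst (fst p))" "continuous_map ?P U (\<lambda>p. snd (fst p))"
      "continuous_map ?P S (\<lambda>p. fst (snd p))" "continuous_map ?P U (\<lambda>p. snd (snd p))"
    by (metis (no_types) continuous_map_fst continuous_map_snd continuous_map_compose[unfolded o_def])+
  have "continuous_map ?P (prod_topology S U)
      (\<lambda>p. (fst (fst p) \<otimes>\<^bsub>G\<^esub> fst (snd p), snd (fst p) \<otimes>\<^bsub>K\<^esub> snd (snd p)))"
    by (intro continuous_map_pairedI topological_group_mult[OF G] topological_group_mult[OF K] p)
  moreover have "continuous_map (prod_topology S U) (prod_topology S U)
      (\<lambda>p. (inv\<^bsub>G\<^esub> fst p, inv\<^bsub>K\<^esub> snd p))"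
    by (intro continuous_map_pairedI topological_group_inv[OF G] topological_group_inv[OF K]
        continuous_map_fst continuous_map_snd)
  then have "continuous_map (prod_topology S U) (prod_topology S U) (\<lambda>p. inv\<^bsub>G \<times>\<times> K\<^esub> p)"
    by (rule continuous_map_eq) (use top grp in \<open>auto simp: inv_DirProd\<close>)
  ultimately show ?thesis
    using DirProd_group[OF grp] top by (simp add: topological_group_def split_def mult_DirProd')
qed

lemma topological_group_subgroup:
  fixes G (structure)
  assumes G: "topological_group G S" and A: "subgroup A G"
  shows "topological_group (G\<lparr>carrier := A\<rparr>) (subtopology S A)"
proof -
  interpret group G
    by (rule topological_group_imp_group[OF G])
  have A': "A \<subseteq> carrier G" "group (G\<lparr>carrier := A\<rparr>)"
    using A subgroup.subset subgroup_imp_group by auto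
  note closed = subgroup.m_closed[OF A] subgroup.m_inv_closed[OF A]
  have top: "topspace S \<inter> A = A"
    using A' topological_group_topspace[OF G] by auto
  let ?T = "subtopology S A"
  have id: "continuous_map ?T S (\<lambda>x. x)"
    by (rule continuous_map_from_subtopology) simp
  have "continuous_map (prod_topology ?T ?T) S (\<lambda>p. fst p \<otimes> snd p)"
    by (intro topological_group_mult[OF G]
        continuous_map_compose[OF continuous_map_fst id, unfolded o_def]
        continuous_map_compose[OF continuous_map_snd id, unfolded o_def])
  then have "continuous_map (prod_topology ?T ?T) ?T (\<lambda>p. fst p \<otimes> snd p)"
    by (rule continuous_map_into_subtopology) (auto simp: closed)
  moreover have "continuous_map ?T S (\<lambda>x. inv x)"
    by (intro topological_group_inv[OF G] id)
  then have "continuous_map ?T ?T (\<lambda>x. inv x)"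
    by (rule continuous_map_into_subtopology) (auto simp: closed)
  then have "continuous_map ?T ?T (\<lambda>x. inv\<^bsub>G\<lparr>carrier := A\<rparr>\<^esub> x)"
    by (rule continuous_map_eq) (simp add: A)
  ultimately show ?thesis
    using A' top by (simp add: topological_group_def split_def)
qed

section \<open>Neighbourhoods and closures in product topologies\<close>

lemma openin_prod_topologyE:
  assumes "openin (prod_topology W Y) O'" "(x, y) \<in> O'"
  obtains U V where "openin W U" "openin Y V" "x \<in> U" "y \<in> V" "U \<times> V \<subseteq> O'"
  using openin_prod_topology_alt[THEN iffD1, OF assms(1), THEN spec, THEN spec, THEN mp, OF assms(2)]
    that by blast

lemma openin_product_topologyE:
  assumes "openin (product_topology S I) O'" "x \<in> O'"
  obtains B where "finite {i\<in>I. B i \<noteq> topspace (S i)}" "\<forall>i\<in>I. openin (S i) (B i)"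
    "x \<in> PiE I B" "PiE I B \<subseteq> O'"
  using openin_product_topology_alt[THEN iffD1, THEN bspec, OF assms] that by (elim exE conjE) auto

text \<open>Closure commutes with binary products, so a jointly continuous operation takes a pair of
  limit points to a limit point. It is applied to multiplication and to conjugation.\<close>

lemma continuous_map_closure2:
  assumes "continuous_map (prod_topology W Y) Z f"
    and "\<And>a b. a \<in> A \<Longrightarrow> b \<in> B \<Longrightarrow> f (a, b) \<in> C"
    and "a \<in> W closure_of A" "b \<in> Y closure_of B"
  shows "f (a, b) \<in> Z closure_of C"
proof -
  have "f ` (A \<times> B) \<subseteq> C"
    using assms(2) by auto
  then have "f ` ((W closure_of A) \<times> (Y closure_of B)) \<subseteq> Z closure_of C"
    using continuous_map_image_closure_subset[OF assms(1), of "A \<times> B"] closure_of_mono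
    unfolding closure_of_Times by blast
  then show ?thesis
    using assms(3,4) by blast
qed

lemma subgroup_closure_of:
  fixes G (structure)
  assumes G: "topological_group G S" and A: "subgroup A G"
  shows "subgroup (S closure_of A) G"
proof -
  interpret group G
    by (rule topological_group_imp_group[OF G])
  have top: "topspace S = carrier G"
    by (rule topological_group_topspace[OF G])
  have sub: "A \<subseteq> S closure_of A"
    using A top closure_of_subset subgroup.subset by metis
  show ?thesis
  proof (rule subgroupI)
    show "S closure_of A \<subseteq> carrier G"
      using top closure_of_subset_topspace by metis
    show "S closure_of A \<noteq> {}"
      using sub subgroup.one_closed[OF A] by blast
    show "inv a \<in> S closure_of A" if "a \<in> S closure_of A" for a
    proof -
      have "(\<lambda>x. inv x) ` A \<subseteq> A"
        using A by (auto simp: subgroup.m_inv_closed)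
      moreover have "continuous_map S S (\<lambda>x. inv x)"
        using G by (simp add: topological_group_def)
      ultimately show ?thesis
        using that continuous_map_image_closure_subset[of S S "\<lambda>x. inv x" A] closure_of_mono by blast
    qed
    show "a \<otimes> b \<in> S closure_of A" if "a \<in> S closure_of A" "b \<in> S closure_of A" for a b
    proof -
      have "continuous_map (prod_topology S S) S (\<lambda>(x, y). x \<otimes> y)"
        using G by (simp add: topological_group_def)
      from continuous_map_closure2[OF this, of A A A a b] show ?thesis
        using that A by (simp add: subgroup.m_closed)
    qed
  qed
qed

section \<open>Approximating a subgroup on a set of coordinates\<close>

text \<open>The coordinates outside \<open>J\<close> are free, while the component in
  \<open>K\<close> is kept. With \<open>E\<close> the carrier of the product group this enlarges a
  subgroup \<open>A\<close> by all elements \<open>(u, 1)\<close> with \<open>u\<close> trivial on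
  \<open>J\<close>: for empty \<open>J\<close> only the projection of \<open>A\<close> to
  \<open>K\<close> matters, and for \<open>J = I\<close> the set is \<open>A\<close> itself.\<close>

definition agreeing_on :: "'i set \<Rightarrow> ('i \<Rightarrow> 'g) set \<Rightarrow> (('i \<Rightarrow> 'g) \<times> 'k) set \<Rightarrow> (('i \<Rightarrow> 'g) \<times> 'k) set" where
  "agreeing_on J E A = {(x, y). x \<in> E \<and> (\<exists>a. (a, y) \<in> A \<and> (\<forall>j\<in>J. x j = a j))}"

text \<open>A basic neighbourhood of \<open>x\<close> restricts only finitely many coordinates.
  Those in \<open>J\<close> are handled by the hypothesis for a finite \<open>F\<close>, and those
  outside \<open>J\<close> are free and can be copied from \<open>x\<close>.\<close>

lemma closure_of_agreeing_on:
  assumes A: "A \<subseteq> E \<times> topspace U" and E: "E = topspace (product_topology S I)"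
    and x: "x \<in> E" and "J \<subseteq> I"
    and fin: "\<And>F. finite F \<Longrightarrow> F \<subseteq> J \<Longrightarrow> \<exists>x'. (\<forall>j\<in>F. x' j = x j) \<and>
      (x', y) \<in> prod_topology (product_topology S I) U closure_of agreeing_on F E A"
  shows "(x, y) \<in> prod_topology (product_topology S I) U closure_of agreeing_on J E A"
  unfolding in_closure_of
proof (intro conjI allI impI)
  obtain x' where "(x', y) \<in> prod_topology (product_topology S I) U closure_of agreeing_on {} E A"
    using fin[of "{}"] by auto
  then have "y \<in> topspace U"
    by (simp add: in_closure_of)
  then show "(x, y) \<in> topspace (prod_topology (product_topology S I) U)"
    using x E by simp
  fix W assume "(x, y) \<in> W \<and> openin (prod_topology (product_topology S I) U) W"
  then obtain M V where MV: "openin (product_topology S I) M" "openin U V" "x \<in> M" "y \<in> V" "M \<times> V \<subseteq> W"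
    using openin_prod_topologyE by metis
  from MV(1,3) obtain B where B: "finite {i\<in>I. B i \<noteq> topspace (S i)}" "\<forall>i\<in>I. openin (S i) (B i)"
      "x \<in> PiE I B" "PiE I B \<subseteq> M"
    by (rule openin_product_topologyE)
  define F where "F = {i\<in>J. B i \<noteq> topspace (S i)}"
  have "finite F" "F \<subseteq> J"
    using \<open>J \<subseteq> I\<close> by (auto simp: F_def intro: finite_subset[OF _ B(1)])
  then obtain x' where x': "\<forall>j\<in>F. x' j = x j"
      "(x', y) \<in> prod_topology (product_topology S I) U closure_of agreeing_on F E A"
    using fin by blast
  \<comment> \<open>\<open>x'\<close> agrees with \<open>x\<close> only on \<open>F\<close>, so the
    neighbourhood is relaxed to the whole factor at every other index; otherwise it might miss
    \<open>x'\<close>.\<close>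
  define B' where "B' i = (if i \<in> F then B i else topspace (S i))" for i
  have "openin (product_topology S I) (PiE I B')"
    unfolding openin_PiE_gen
    by (rule disjI2, rule conjI, rule finite_subset[OF _ \<open>finite F\<close>]) (use B in \<open>auto simp: B'_def\<close>)
  then have "openin (prod_topology (product_topology S I) U) (PiE I B' \<times> V)"
    using MV by (simp add: openin_prod_Times_iff)
  moreover have "x' \<in> PiE I B'"
    using x' B(3) by (auto simp: in_closure_of PiE_iff B'_def)
  ultimately have "\<exists>p. p \<in> agreeing_on F E A \<and> p \<in> PiE I B' \<times> V"
    by (intro x'(2)[unfolded in_closure_of, THEN conjunct2, THEN spec, THEN mp])
      (simp add: \<open>y \<in> V\<close>)
  then obtain z b where "(z, b) \<in> agreeing_on F E A" "(z, b) \<in> PiE I B' \<times> V"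
    unfolding split_paired_Ex by blast
  then obtain a where "(a, b) \<in> A" "\<forall>j\<in>F. z j = a j" "z \<in> PiE I B'" and "b \<in> V"
    by (auto simp: agreeing_on_def)
  moreover have "F \<subseteq> I"
    using \<open>F \<subseteq> J\<close> \<open>J \<subseteq> I\<close> by blast
  ultimately have a: "(a, b) \<in> A" "\<forall>j\<in>F. a j \<in> B j" "b \<in> V"
    by (simp_all add: B'_def) (metis PiE_mem B'_def subsetD)
  have aE: "a \<in> E"
    using A a(1) by auto
  \<comment> \<open>On \<open>J\<close> the point must follow \<open>a\<close> to lie in
    \<open>agreeing_on J E A\<close>; elsewhere it follows \<open>x\<close> to stay in the
    neighbourhood \<open>B\<close>. At indices of \<open>J\<close> outside \<open>F\<close> the set
    \<open>B\<close> imposes nothing.\<close>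
  define w where "w = (\<lambda>i\<in>I. if i \<in> J then a i else x i)"
  have "w \<in> PiE I B"
    using a(2) aE B(3) by (auto simp: w_def PiE_iff E F_def)
  moreover have "w \<in> E"
    using aE x by (auto simp: w_def PiE_iff E)
  moreover have "\<forall>j\<in>J. w j = a j"
    using \<open>J \<subseteq> I\<close> by (auto simp: w_def)
  ultimately have "(w, b) \<in> agreeing_on J E A" "(w, b) \<in> W"
    using a MV(5) B(4) by (auto simp: agreeing_on_def)
  then show "\<exists>p. p \<in> agreeing_on J E A \<and> p \<in> W"
    by blast
qed

lemma subgroup_agreeing_on:
  assumes G: "\<And>i. i \<in> I \<Longrightarrow> group (G i)" and K: "group K" and "J \<subseteq> I"
    and A: "subgroup A (product_group I G \<times>\<times> K)"
  shows "subgroup (agreeing_on J (carrier (product_group I G)) A) (product_group I G \<times>\<times> K)"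
proof -
  let ?P = "product_group I G"
  have P: "group ?P" "group (?P \<times>\<times> K)"
    using G K by (auto intro!: DirProd_group)
  interpret PG: group ?P by fact
  interpret PK: group "?P \<times>\<times> K" by fact
  note sub = subgroup.mem_carrier[OF A]
  show ?thesis
  proof (rule PK.subgroupI)
    show "agreeing_on J (carrier ?P) A \<subseteq> carrier (?P \<times>\<times> K)"
      using sub by (auto simp: agreeing_on_def)
    have "(\<one>\<^bsub>?P\<^esub>, \<one>\<^bsub>K\<^esub>) \<in> A"
      using subgroup.one_closed[OF A] by simp
    then have "(\<one>\<^bsub>?P\<^esub>, \<one>\<^bsub>K\<^esub>) \<in> agreeing_on J (carrier ?P) A"
      unfolding agreeing_on_def using PG.one_closed by blast
    then show "agreeing_on J (carrier ?P) A \<noteq> {}"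
      by blast
  next
    fix p assume "p \<in> agreeing_on J (carrier ?P) A"
    then obtain x y a where p: "p = (x, y)" "x \<in> carrier ?P" "(a, y) \<in> A" "\<forall>j\<in>J. x j = a j"
      by (auto simp: agreeing_on_def)
    have a: "a \<in> carrier ?P" "y \<in> carrier K"
      using sub[OF p(3)] by auto
    have "(inv\<^bsub>?P\<^esub> a, inv\<^bsub>K\<^esub> y) \<in> A"
      using subgroup.m_inv_closed[OF A p(3)] inv_DirProd[OF P(1) K a] by simp
    moreover have "\<forall>j\<in>J. (inv\<^bsub>?P\<^esub> x) j = (inv\<^bsub>?P\<^esub> a) j"
      using p a G \<open>J \<subseteq> I\<close> by (auto simp: subset_iff)
    ultimately show "inv\<^bsub>?P \<times>\<times> K\<^esub> p \<in> agreeing_on J (carrier ?P) A"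
      using inv_DirProd[OF P(1) K p(2) a(2)] PG.inv_closed[OF p(2)]
      unfolding agreeing_on_def p(1) by auto
  next
    fix p q assume "p \<in> agreeing_on J (carrier ?P) A" "q \<in> agreeing_on J (carrier ?P) A"
    then obtain x y a x' y' a' where p: "p = (x, y)" "x \<in> carrier ?P" "(a, y) \<in> A" "\<forall>j\<in>J. x j = a j"
      and q: "q = (x', y')" "x' \<in> carrier ?P" "(a', y') \<in> A" "\<forall>j\<in>J. x' j = a' j"
      by (auto simp: agreeing_on_def)
    have "(a \<otimes>\<^bsub>?P\<^esub> a', y \<otimes>\<^bsub>K\<^esub> y') \<in> A"
      using subgroup.m_closed[OF A p(3) q(3)] by simp
    moreover have "\<forall>j\<in>J. (x \<otimes>\<^bsub>?P\<^esub> x') j = (a \<otimes>\<^bsub>?P\<^esub> a') j"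
      using p q \<open>J \<subseteq> I\<close> by (auto simp: subset_iff)
    ultimately show "p \<otimes>\<^bsub>?P \<times>\<times> K\<^esub> q \<in> agreeing_on J (carrier ?P) A"
      using PG.m_closed[OF p(2) q(2)]
      unfolding agreeing_on_def p(1) q(1) mult_DirProd by blast
  qed
qed

section \<open>Preimages, pullbacks and maps of product groups\<close>

lemma subgroup_vimage:
  assumes "group_hom G H h" "subgroup A H"
  shows "subgroup {x \<in> carrier G. h x \<in> A} G"
proof -
  interpret group_hom G H h
    by fact
  show ?thesis
    by (rule G.subgroupI)
      (use assms(2) subgroup.one_closed[OF assms(2)] hom_one in
        \<open>auto simp: subgroup.m_closed subgroup.m_inv_closed intro: exI[of _ "\<one>\<^bsub>G\<^esub>"]\<close>)
qed

lemma subgroup_pullback_carrier: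
  assumes "group_hom G H f" "group_hom K H g"
  shows "subgroup (pullback_carrier G K f g) (G \<times>\<times> K)"
proof -
  interpret f: group_hom G H f by fact
  interpret g: group_hom K H g by fact
  interpret GK: group "G \<times>\<times> K"
    by (rule DirProd_group) unfold_locales
  show ?thesis
  proof (rule GK.subgroupI)
    have "(\<one>\<^bsub>G\<^esub>, \<one>\<^bsub>K\<^esub>) \<in> pullback_carrier G K f g"
      by (simp add: pullback_carrier_def)
    then show "pullback_carrier G K f g \<noteq> {}"
      by blast
  qed (auto simp: pullback_carrier_def inv_DirProd[OF f.G.is_group g.G.is_group])
qed

text \<open>The target keeps only the factors in \<open>J\<close>, so that the pairs satisfying just
  the equations indexed by \<open>J\<close> again form a pullback.\<close>

lemma product_map_hom:
  assumes "\<And>i. i \<in> I \<Longrightarrow> f i \<in> hom (G i) (H i)" "J \<subseteq> I"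
  shows "product_map J f \<in> hom (product_group I G) (product_group J H)"
proof (rule homI)
  show "product_map J f x \<in> carrier (product_group J H)" if "x \<in> carrier (product_group I G)" for x
    using that assms by (fastforce simp: product_map_def hom_def)
  show "product_map J f (x \<otimes>\<^bsub>product_group I G\<^esub> y) =
      product_map J f x \<otimes>\<^bsub>product_group J H\<^esub> product_map J f y"
    if "x \<in> carrier (product_group I G)" "y \<in> carrier (product_group I G)" for x y
  proof -
    have "f i (x i \<otimes>\<^bsub>G i\<^esub> y i) = f i (x i) \<otimes>\<^bsub>H i\<^esub> f i (y i)" if "i \<in> J" for i
      by (rule hom_mult[OF assms(1)])
        (use that \<open>J \<subseteq> I\<close> \<open>x \<in> _\<close> \<open>y \<in> _\<close> in auto)
    then show ?thesis
      using \<open>J \<subseteq> I\<close> by (auto simp: product_map_def fun_eq_iff restrict_def)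
  qed
qed

lemma restrict_product_group_hom:
  "J \<subseteq> I \<Longrightarrow> (\<lambda>x. restrict x J) \<in> hom (product_group I G) (product_group J G)"
  by (rule homI) (auto simp: fun_eq_iff restrict_def)

lemma coordinate_hom: "i \<in> I \<Longrightarrow> (\<lambda>x. x i) \<in> hom (product_group I G) (G i)"
  by (rule homI) auto

section \<open>Products of c-proper homomorphisms\<close>

text \<open>The test groups given to \<open>f i\<close> are subgroups of the product of all
  \<open>G i\<close> with \<open>K\<close>, whence the type in \<open>proper\<close>.\<close>

lemma c_proper_product:
  fixes I :: "'i set"
    and G :: "'i \<Rightarrow> 'g monoid" and S :: "'i \<Rightarrow> 'g topology"
    and H :: "'i \<Rightarrow> 'h monoid" and T :: "'i \<Rightarrow> 'h topology"
    and f :: "'i \<Rightarrow> 'g \<Rightarrow> 'h"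
  assumes G: "\<And>i. i \<in> I \<Longrightarrow> topological_group (G i) (S i)"
    and H: "\<And>i. i \<in> I \<Longrightarrow> topological_group (H i) (T i)"
    and f: "\<And>i. i \<in> I \<Longrightarrow> continuous_hom (G i) (S i) (H i) (T i) (f i)"
    and proper: "\<And>i. i \<in> I \<Longrightarrow> c_proper TYPE(('i \<Rightarrow> 'g) \<times> 'k) (G i) (S i) (H i) (T i) (f i)"
  shows "c_proper TYPE('k) (product_group I G) (product_topology S I)
          (product_group I H) (product_topology T I) (product_map I f)"
  unfolding c_proper_def c_closed_def
proof (intro allI impI, elim conjE)
  fix K :: "'k monoid" and U :: "'k topology" and g :: "'k \<Rightarrow> 'i \<Rightarrow> 'h"
    and A :: "(('i \<Rightarrow> 'g) \<times> 'k) set"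
  let ?P = "product_group I G" and ?S = "product_topology S I"
  let ?PK = "?P \<times>\<times> K" and ?SU = "prod_topology ?S U"
  assume K: "topological_group K U"
    and g: "continuous_hom K U (product_group I H) (product_topology T I) g"
    and A: "subgroup A (pullback_group ?P K (product_map I f) g)"
      "closedin (pullback_topology ?P ?S K U (product_map I f) g) A"
  note [simp] = topological_group_imp_group[OF G] topological_group_imp_group[OF H]
    topological_group_imp_group[OF K]
  have top: "topspace ?S = carrier ?P" "topspace U = carrier K"
    by (rule topological_group_topspace, rule topological_group_product, erule G)
      (rule topological_group_topspace[OF K])
  have PK: "topological_group ?PK ?SU"
    by (intro topological_group_DirProd topological_group_product G K)
  interpret PK: group ?PK
    by (rule topological_group_imp_group[OF PK])
  have g_hom: "g \<in> hom K (product_group I H)"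
    using g by (simp add: continuous_hom_def)
  have f_hom: "f i \<in> hom (G i) (H i)" if "i \<in> I" for i
    using f[OF that] by (simp add: continuous_hom_def)

  \<comment> \<open>Only the equations indexed by \<open>J\<close> are imposed; \<open>L I\<close>
    is the pullback that contains \<open>A\<close>.\<close>
  define L where "L J = pullback_carrier ?P K (product_map J f) (\<lambda>y. restrict (g y) J)" for J
  have L_iff: "(x, y) \<in> L J \<longleftrightarrow> x \<in> carrier ?P \<and> y \<in> carrier K \<and> (\<forall>j\<in>J. f j (x j) = g y j)" for x y J
    by (auto simp: L_def pullback_carrier_def product_map_def fun_eq_iff restrict_def)
  have L_I: "pullback_carrier ?P K (product_map I f) g = L I"
  proof -
    have "restrict (g y) I = g y" if "y \<in> carrier K" for y
      using hom_in_carrier[OF g_hom that] by (auto simp: PiE_iff extensional_restrict)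
    then show ?thesis
      by (auto simp: L_def pullback_carrier_def)
  qed
  have L_subgroup: "subgroup (L J) ?PK" if "J \<subseteq> I" for J
    unfolding L_def
  proof (rule subgroup_pullback_carrier)
    have [simp]: "group (product_group J H)"
      using that by (simp add: subset_iff)
    show "group_hom ?P (product_group J H) (product_map J f)"
      using product_map_hom[OF f_hom that] by (simp add: group_hom_def group_hom_axioms_def)
    have "(\<lambda>x. restrict x J) \<circ> g \<in> hom K (product_group J H)"
      by (rule hom_compose[OF g_hom restrict_product_group_hom[OF that]])
    then show "group_hom K (product_group J H) (\<lambda>y. restrict (g y) J)"
      by (simp add: group_hom_def group_hom_axioms_def o_def)
  qed
  have A_sub: "subgroup A ?PK"
    using A(1) PK.incl_subgroup[OF L_subgroup[OF order_refl]]
    unfolding pullback_group_def L_I by blast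
  have "A \<subseteq> L I"
    using subgroup.subset[OF A(1)] by (simp add: pullback_group_def L_I)

  \<comment> \<open>The closure is taken in the fixed ambient group. For \<open>J\<close> inside
    \<open>I\<close> the set \<open>agreeing_on J (carrier ?P) A\<close> lies in \<open>L J\<close>,
    so its closure relative to \<open>L J\<close> is \<open>L J \<inter> C J\<close>.\<close>
  define C where "C J = ?SU closure_of agreeing_on J (carrier ?P) A" for J
  have agreeing_sub: "agreeing_on J (carrier ?P) A \<subseteq> topspace ?SU" for J
    using subgroup.subset[OF A_sub] top by (auto simp: agreeing_on_def)
  have agreeing_C: "agreeing_on J (carrier ?P) A \<subseteq> C J" for J
    unfolding C_def by (rule closure_of_subset[OF agreeing_sub])
  have C_subgroup: "subgroup (C J) ?PK" if "J \<subseteq> I" for J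
    unfolding C_def
    by (intro subgroup_closure_of[OF PK] subgroup_agreeing_on that A_sub) auto

  have step: "\<exists>t\<in>carrier (G i). (x(i := t), y) \<in> L (insert i J) \<inter> C (insert i J)"
    if J: "J \<subseteq> I" "i \<in> I - J" and xy: "(x, y) \<in> L J \<inter> C J" for J i x y
  proof -
    have i: "i \<in> I" "insert i J \<subseteq> I"
      using J by auto
    \<comment> \<open>The test group for \<open>f i\<close> is \<open>L J\<close>, mapped to
      \<open>H i\<close> by the component of \<open>g\<close> at \<open>i\<close>. Its pullback
      consists of triples \<open>(t, x, y)\<close> in which \<open>t\<close> is a candidate for the
      new coordinate.\<close>
    let ?K = "?PK\<lparr>carrier := L J\<rparr>" and ?U = "subtopology ?SU (L J)" and ?g = "\<lambda>p. g (snd p) i"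
    have K': "topological_group ?K ?U"
      by (rule topological_group_subgroup[OF PK L_subgroup[OF J(1)]])
    then have [simp]: "group ?K"
      by (rule topological_group_imp_group)
    have gi: "(\<lambda>y. g y i) \<in> hom K (H i)"
      using hom_compose[OF g_hom coordinate_hom[OF i(1)]] by (simp add: o_def)
    have "?g \<in> hom ?K (H i)"
      using hom_in_carrier[OF gi] hom_mult[OF gi] i
      by (intro homI) (auto simp: L_iff mult_DirProd')
    moreover have "continuous_map ?U (T i) ?g"
    proof (rule continuous_map_from_subtopology)
      have "continuous_map U (T i) (\<lambda>y. g y i)"
        using g i by (simp add: continuous_hom_def continuous_map_componentwise)
      then show "continuous_map ?SU (T i) ?g"
        using continuous_map_compose[OF continuous_map_snd] by (fastforce simp: o_def)
    qed
    ultimately have g': "continuous_hom ?K ?U (H i) (T i) ?g"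
      by (simp add: continuous_hom_def)
    let ?Q = "pullback_group (G i) ?K (f i) ?g" and ?V = "pullback_topology (G i) (S i) ?K ?U (f i) ?g"
    \<comment> \<open>As \<open>i\<close> is not in \<open>J\<close>, the value \<open>x i\<close>
      is unconstrained in \<open>L J\<close>. This map overwrites it with \<open>t\<close>, and the
      pullback equation for \<open>t\<close> puts the result in
      \<open>L (insert i J)\<close>.\<close>
    let ?\<phi> = "\<lambda>(t, x, y). (x(i := t), y)"
    have Q_sub: "subgroup (pullback_carrier (G i) ?K (f i) ?g) (G i \<times>\<times> ?K)"
      using f_hom i g' by (intro subgroup_pullback_carrier)
        (auto simp: group_hom_def group_hom_axioms_def continuous_hom_def)
    have Q: "group ?Q"
      using group.subgroup_imp_group[OF DirProd_group Q_sub] i by (simp add: pullback_group_def)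
    have Q_iff: "(t, x, y) \<in> carrier ?Q \<longleftrightarrow> t \<in> carrier (G i) \<and> (x, y) \<in> L J \<and> f i t = g y i" for t x y
      by (auto simp: pullback_group_def pullback_carrier_def)
    have \<phi>_hom: "?\<phi> \<in> hom ?Q ?PK"
    proof (rule homI)
      show "?\<phi> p \<in> carrier ?PK" if "p \<in> carrier ?Q" for p
        using that i by (cases p) (auto simp: Q_iff L_iff PiE_iff extensional_def)
      show "?\<phi> (p \<otimes>\<^bsub>?Q\<^esub> q) = ?\<phi> p \<otimes>\<^bsub>?PK\<^esub> ?\<phi> q" if "p \<in> carrier ?Q" "q \<in> carrier ?Q" for p q
        using i by (cases p; cases q) (auto simp: pullback_group_def fun_eq_iff)
    qed
    have V_top: "topspace ?V = carrier ?Q"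
      using K' i topological_group_topspace[OF G] subgroup.subset[OF L_subgroup[OF J(1)]] top
      by (auto simp: pullback_topology_def pullback_group_def pullback_carrier_def)
    have \<phi>_cont: "continuous_map ?V ?SU ?\<phi>"
    proof -
      have id: "continuous_map ?V (prod_topology (S i) ?SU) (\<lambda>p. p)"
        unfolding pullback_topology_def prod_topology_subtopology subtopology_subtopology
        by (rule continuous_map_from_subtopology) simp
      note snd_cont = continuous_map_compose[OF id continuous_map_snd]
      have c: "continuous_map ?V (S i) fst" "continuous_map ?V ?S (\<lambda>p. fst (snd p))"
          "continuous_map ?V U (\<lambda>p. snd (snd p))"
        using continuous_map_compose[OF id continuous_map_fst]
          continuous_map_compose[OF snd_cont continuous_map_fst]
          continuous_map_compose[OF snd_cont continuous_map_snd]
        by (simp_all add: o_def)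
      have "continuous_map ?V ?S (\<lambda>p. (fst (snd p))(i := fst p))"
        unfolding continuous_map_componentwise
      proof (intro conjI ballI)
        show "(\<lambda>p. (fst (snd p))(i := fst p)) ` topspace ?V \<subseteq> extensional I"
          using i by (auto simp: V_top Q_iff L_iff PiE_iff extensional_def)
        show "continuous_map ?V (S k) (\<lambda>p. ((fst (snd p))(i := fst p)) k)" if "k \<in> I" for k
          using c that by (cases "k = i") (auto simp: continuous_map_componentwise)
      qed
      then have "continuous_map ?V ?SU (\<lambda>p. ((fst (snd p))(i := fst p), snd (snd p)))"
        using c by (intro continuous_map_pairedI)
      then show ?thesis
        by (simp add: split_def)
    qed
    \<comment> \<open>A closed subgroup, being a preimage of \<open>C (insert i J)\<close>. Its
      projection consists of the points of \<open>L J\<close> that can be moved into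
      \<open>C (insert i J)\<close> by an admissible change at \<open>i\<close>; c-properness of
      \<open>f i\<close> makes it closed in \<open>L J\<close>.\<close>
    define B where "B = {p \<in> carrier ?Q. ?\<phi> p \<in> C (insert i J)}"
    have "subgroup B ?Q"
      unfolding B_def using Q \<phi>_hom PK.is_group
      by (intro subgroup_vimage[OF _ C_subgroup[OF i(2)]]) (simp add: group_hom_def group_hom_axioms_def)
    moreover have "closedin ?V B"
      using closedin_continuous_map_preimage[OF \<phi>_cont, of "C (insert i J)"]
      by (simp add: B_def C_def V_top)
    ultimately have "closedin ?U (snd ` B)"
      using proper[OF i(1)] K' g' unfolding c_proper_def c_closed_def by blast
    then obtain Z where Z: "closedin ?SU Z" "snd ` B = Z \<inter> L J"
      by (auto simp: closedin_subtopology)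
    \<comment> \<open>If \<open>a\<close> witnesses membership of \<open>(x, y)\<close>, then
      \<open>t = a i\<close> is an admissible change. Closedness of the projection extends this from
      the subgroup to its limit points in \<open>L J\<close>.\<close>
    have "agreeing_on J (carrier ?P) A \<subseteq> snd ` B"
    proof clarify
      fix x y assume *: "(x, y) \<in> agreeing_on J (carrier ?P) A"
      then obtain a where a: "x \<in> carrier ?P" "(a, y) \<in> A" "\<forall>j\<in>J. x j = a j"
        by (auto simp: agreeing_on_def)
      then have aL: "a \<in> carrier ?P" "y \<in> carrier K" "\<forall>j\<in>I. f j (a j) = g y j"
        using \<open>A \<subseteq> L I\<close> L_iff by blast+
      have "x(i := a i) \<in> carrier ?P"
        using a aL i by (auto simp: PiE_iff extensional_def)
      then have "(x(i := a i), y) \<in> agreeing_on (insert i J) (carrier ?P) A"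
        using a by (auto simp: agreeing_on_def)
      moreover have "(a i, x, y) \<in> carrier ?Q"
        using a aL i J by (auto simp: Q_iff L_iff PiE_iff subset_iff)
      ultimately have "(a i, x, y) \<in> B"
        using agreeing_C by (auto simp: B_def)
      then show "(x, y) \<in> snd ` B"
        by (rule rev_image_eqI) simp
    qed
    then have "C J \<subseteq> Z"
      unfolding C_def using Z by (intro closure_of_minimal) auto
    then have "(x, y) \<in> snd ` B"
      using xy Z by blast
    then obtain t where t: "(t, x, y) \<in> B"
      by force
    then have "(x(i := t), y) \<in> C (insert i J)" "t \<in> carrier (G i)" "f i t = g y i"
      by (auto simp: B_def Q_iff)
    moreover have "(x(i := t), y) \<in> L (insert i J)"
      using xy J i calculation by (auto simp: L_iff PiE_iff extensional_def)
    ultimately show ?thesis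
      by blast
  qed

  have "y \<in> snd ` A" if y: "y \<in> U closure_of (snd ` A)" for y
  proof -
    have yK: "y \<in> carrier K"
      using y top by (simp add: in_closure_of)
    have "\<exists>x\<in>\<Pi>\<^sub>E i\<in>I. carrier (G i). (x, y) \<in> L I \<inter> C I"
    proof (rule finite_character_selection)
      \<comment> \<open>With no coordinate fixed, being in the closure says only that
        \<open>y\<close> is in the closure of the projection of \<open>A\<close>, so any element can
        start the selection.\<close>
      have "agreeing_on {} (carrier ?P) A = carrier ?P \<times> snd ` A"
        by (force simp: agreeing_on_def)
      moreover have "?S closure_of carrier ?P = carrier ?P"
        using closure_of_topspace[of ?S] unfolding top(1) .
      ultimately have "C {} = carrier ?P \<times> U closure_of (snd ` A)"
        by (simp add: C_def closure_of_Times)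
      moreover have "\<one>\<^bsub>?P\<^esub> \<in> carrier ?P"
        by (intro group.is_monoid monoid.one_closed) simp
      ultimately show "\<one>\<^bsub>?P\<^esub> \<in> (\<Pi>\<^sub>E i\<in>I. carrier (G i))" "(\<one>\<^bsub>?P\<^esub>, y) \<in> L {} \<inter> C {}"
        using y yK by (simp_all add: L_iff)
    next
      fix J F x assume "(x, y) \<in> L J \<inter> C J" "F \<subseteq> J"
      moreover have "C J \<subseteq> C F"
        unfolding C_def using \<open>F \<subseteq> J\<close> by (intro closure_of_mono) (auto simp: agreeing_on_def)
      ultimately show "(x, y) \<in> L F \<inter> C F"
        by (auto simp: L_iff)
    next
      fix J x assume J: "J \<subseteq> I" and x: "x \<in> (\<Pi>\<^sub>E i\<in>I. carrier (G i))"
        and fin: "\<And>F. finite F \<Longrightarrow> F \<subseteq> J \<Longrightarrow>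
          \<exists>x'\<in>\<Pi>\<^sub>E i\<in>I. carrier (G i). (\<forall>j\<in>F. x' j = x j) \<and> (x', y) \<in> L F \<inter> C F"
      \<comment> \<open>Each equation involves a single coordinate, so singletons \<open>F\<close>
        suffice for this half.\<close>
      have "f j (x j) = g y j" if "j \<in> J" for j
        using fin[of "{j}"] that by (auto simp: L_iff)
      moreover have "(x, y) \<in> C J"
        unfolding C_def
      proof (rule closure_of_agreeing_on[OF _ _ _ J])
        show "A \<subseteq> carrier ?P \<times> topspace U"
          using subgroup.subset[OF A_sub] top by simp
        show "\<exists>x'. (\<forall>j\<in>F. x' j = x j) \<and> (x', y) \<in> ?SU closure_of agreeing_on F (carrier ?P) A"
          if "finite F" "F \<subseteq> J" for F
          using fin[OF that] unfolding C_def by blast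
      qed (use x top in auto)
      ultimately show "(x, y) \<in> L J \<inter> C J"
        using x yK by (simp add: L_iff)
    qed (rule step)
    then obtain x where x: "(x, y) \<in> L I" "(x, y) \<in> C I"
      by blast
    obtain Z where Z: "closedin ?SU Z" "A = Z \<inter> L I"
      using A(2) by (auto simp: pullback_topology_def L_I closedin_subtopology)
    \<comment> \<open>Agreement on all of \<open>I\<close> is equality. Hence \<open>C I\<close>
      adds only limit points of \<open>A\<close>, and those in \<open>L I\<close> belong to
      \<open>A\<close>, which is closed there.\<close>
    have "agreeing_on I (carrier ?P) A \<subseteq> A"
    proof clarify
      fix z b assume "(z, b) \<in> agreeing_on I (carrier ?P) A"
      then obtain a where a: "z \<in> carrier ?P" "(a, b) \<in> A" "\<forall>j\<in>I. z j = a j"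
        by (auto simp: agreeing_on_def)
      moreover have "a \<in> carrier ?P"
        using a subgroup.subset[OF A_sub] by auto
      ultimately have "z = a"
        by (auto intro: PiE_ext)
      then show "(z, b) \<in> A"
        using a by simp
    qed
    then have "C I \<subseteq> Z"
      unfolding C_def using Z by (intro closure_of_minimal) auto
    then show ?thesis
      using x Z by force
  qed
  moreover have "snd ` A \<subseteq> topspace U"
    using subgroup.subset[OF A_sub] top by auto
  ultimately show "closedin U (snd ` A)"
    using closure_of_subset_eq by blast
qed

section \<open>Products of Hausdorff homomorphisms\<close>

text \<open>Distinct points of a fibre differ at some index \<open>i\<close>, where they still lie
  in one fibre of \<open>f i\<close>; a separation there pulls back along the projection.\<close>

lemma fibrewise_Hausdorff_product:
  assumes "\<And>i. i \<in> I \<Longrightarrow> fibrewise_Hausdorff (S i) (f i)"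
  shows "fibrewise_Hausdorff (product_topology S I) (product_map I f)"
  unfolding fibrewise_Hausdorff_def
proof (intro ballI impI, elim conjE)
  fix x y assume x: "x \<in> topspace (product_topology S I)" and y: "y \<in> topspace (product_topology S I)"
    and "x \<noteq> y" and eq: "product_map I f x = product_map I f y"
  then obtain i where i: "i \<in> I" "x i \<noteq> y i"
    by (metis PiE_ext topspace_product_topology)
  have "f i (x i) = f i (y i)"
    using fun_cong[OF eq, of i] i by (simp add: product_map_def)
  then obtain V W where VW: "openin (S i) V" "openin (S i) W" "x i \<in> V" "y i \<in> W" "disjnt V W"
    using assms[OF i(1)] x y i unfolding fibrewise_Hausdorff_def by (force simp: PiE_iff)
  let ?pre = "\<lambda>V. {z \<in> topspace (product_topology S I). z i \<in> V}"
  have "openin (product_topology S I) (?pre V)" "openin (product_topology S I) (?pre W)"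
    using VW openin_continuous_map_preimage[OF continuous_map_product_projection[OF i(1)]] by blast+
  then show "\<exists>V W. openin (product_topology S I) V \<and> openin (product_topology S I) W \<and>
      x \<in> V \<and> y \<in> W \<and> disjnt V W"
    using VW x y by (intro exI[of _ "?pre V"] exI[of _ "?pre W"]) (auto simp: disjnt_iff)
qed

section \<open>Quotients of topological groups\<close>

text \<open>The final topology on the image of \<open>q\<close>; below, \<open>q\<close> sends an
  element to its coset, so the points are sets.\<close>

definition quotient_topology :: "'a topology \<Rightarrow> ('a \<Rightarrow> 'b) \<Rightarrow> 'b topology" where
  "quotient_topology S q =
     topology (\<lambda>V. V \<subseteq> q ` topspace S \<and> openin S {x \<in> topspace S. q x \<in> V})"

lemma openin_quotient_topology:
  "openin (quotient_topology S q) V \<longleftrightarrow>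
     V \<subseteq> q ` topspace S \<and> openin S {x \<in> topspace S. q x \<in> V}"
proof -
  have "istopology (\<lambda>V. V \<subseteq> q ` topspace S \<and> openin S {x \<in> topspace S. q x \<in> V})"
    unfolding istopology_def
  proof (intro conjI allI impI; (elim conjE)?)
    fix V W assume "openin S {x \<in> topspace S. q x \<in> V}" "openin S {x \<in> topspace S. q x \<in> W}"
    then have "openin S ({x \<in> topspace S. q x \<in> V} \<inter> {x \<in> topspace S. q x \<in> W})"
      by blast
    then show "openin S {x \<in> topspace S. q x \<in> V \<inter> W}"
      by (rule back_subst[of "openin S"]) auto
  next
    fix \<K> assume "\<forall>V\<in>\<K>. V \<subseteq> q ` topspace S \<and> openin S {x \<in> topspace S. q x \<in> V}"
    then have "openin S (\<Union>V\<in>\<K>. {x \<in> topspace S. q x \<in> V})"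
      by blast
    then show "openin S {x \<in> topspace S. q x \<in> \<Union>\<K>}"
      by (rule back_subst[of "openin S"]) auto
  qed auto
  then show ?thesis
    by (simp add: quotient_topology_def)
qed

lemma topspace_quotient_topology [simp]: "topspace (quotient_topology S q) = q ` topspace S"
proof -
  have "openin (quotient_topology S q) (q ` topspace S)"
    by (simp add: openin_quotient_topology Collect_conj_eq Int_absorb2 image_subset_iff subset_iff
        flip: Collect_mem_eq)
  then show ?thesis
    using openin_subset openin_topspace by (metis openin_quotient_topology subset_antisym)
qed

lemma quotient_map_quotient_topology: "quotient_map S (quotient_topology S q) q"
  by (simp add: quotient_map_def openin_quotient_topology)

text \<open>A product of two quotient maps may fail to be a quotient map, but openness survives
  products. This is how multiplication descends to a quotient group.\<close>

lemma open_map_prod: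
  assumes f: "open_map W Y f" and g: "open_map W' Y' g"
  shows "open_map (prod_topology W W') (prod_topology Y Y') (\<lambda>p. (f (fst p), g (snd p)))"
  unfolding open_map_def
proof (intro allI impI)
  fix O' assume O': "openin (prod_topology W W') O'"
  show "openin (prod_topology Y Y') ((\<lambda>p. (f (fst p), g (snd p))) ` O')"
    unfolding openin_prod_topology_alt
  proof (intro allI impI)
    fix y y' assume "(y, y') \<in> (\<lambda>p. (f (fst p), g (snd p))) ` O'"
    then obtain x x' where x: "(x, x') \<in> O'" "y = f x" "y' = g x'"
      by auto
    then obtain V V' where V: "openin W V" "openin W' V'" "x \<in> V" "x' \<in> V'" "V \<times> V' \<subseteq> O'"
      using openin_prod_topologyE[OF O' x(1)] by metis
    then have "f ` V \<times> g ` V' \<subseteq> (\<lambda>p. (f (fst p), g (snd p))) ` O'"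
      by force
    then show "\<exists>V V'. openin Y V \<and> openin Y' V' \<and> y \<in> V \<and> y' \<in> V' \<and>
        V \<times> V' \<subseteq> (\<lambda>p. (f (fst p), g (snd p))) ` O'"
      using V x f g unfolding open_map_def by (intro exI[of _ "f ` V"] exI[of _ "g ` V'"]) auto
  qed
qed

lemma (in group) r_coset_eq_iff:
  assumes "subgroup N G" "x \<in> carrier G" "y \<in> carrier G"
  shows "N #> x = N #> y \<longleftrightarrow> x \<otimes> inv y \<in> N"
proof
  assume "N #> x = N #> y"
  then have "x \<in> N #> y"
    using rcos_self[OF assms(2,1)] by simp
  then show "x \<otimes> inv y \<in> N"
    using assms subgroup.rcos_module_imp[OF assms(1) group_axioms] by simp
next
  assume "x \<otimes> inv y \<in> N"
  then have "x \<in> N #> y"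
    using assms subgroup.rcos_module_rev[OF assms(1) group_axioms] by simp
  then show "N #> x = N #> y"
    using repr_independence[OF _ assms(3,1)] by simp
qed

lemma open_map_r_coset:
  fixes G (structure)
  assumes G: "topological_group G S" and N: "subgroup N G"
  shows "open_map S (quotient_topology S (\<lambda>x. N #> x)) (\<lambda>x. N #> x)"
  unfolding open_map_def
proof (intro allI impI)
  interpret group G
    by (rule topological_group_imp_group[OF G])
  note top = topological_group_topspace[OF G]
  fix V assume V: "openin S V"
  then have VG: "V \<subseteq> carrier G"
    using openin_subset top by blast
  \<comment> \<open>The saturation of \<open>V\<close> is the union of its preimages under left
    translation by elements of \<open>N\<close>, each of which is open.\<close>
  have "{x \<in> topspace S. N #> x \<in> (\<lambda>x. N #> x) ` V} = (\<Union>n\<in>N. {x \<in> topspace S. n \<otimes> x \<in> V})"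
  proof (intro equalityI subsetI)
    fix x assume "x \<in> {x \<in> topspace S. N #> x \<in> (\<lambda>x. N #> x) ` V}"
    then obtain v where v: "x \<in> carrier G" "v \<in> V" "N #> v = N #> x"
      using top by auto
    then have "v \<in> carrier G"
      using VG by blast
    then have "v \<otimes> inv x \<in> N" "(v \<otimes> inv x) \<otimes> x = v"
      using v r_coset_eq_iff[OF N] by (simp_all add: m_assoc)
    then show "x \<in> (\<Union>n\<in>N. {x \<in> topspace S. n \<otimes> x \<in> V})"
      using v top by (intro UN_I[of "v \<otimes> inv x"]) auto
  next
    fix x assume "x \<in> (\<Union>n\<in>N. {x \<in> topspace S. n \<otimes> x \<in> V})"
    then obtain n where n: "n \<in> N" "x \<in> carrier G" "n \<otimes> x \<in> V"
      using top by auto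
    have "n \<in> carrier G"
      using n N subgroup.mem_carrier by fast
    then have "n \<otimes> x \<otimes> inv x = n"
      using n by (simp add: m_assoc)
    then have "N #> (n \<otimes> x) = N #> x"
      using n \<open>n \<in> carrier G\<close> r_coset_eq_iff[OF N] by simp
    then show "x \<in> {x \<in> topspace S. N #> x \<in> (\<lambda>x. N #> x) ` V}"
      using n top by (auto intro: rev_image_eqI)
  qed
  moreover have "openin S {x \<in> topspace S. n \<otimes> x \<in> V}" if "n \<in> N" for n
  proof (rule openin_continuous_map_preimage[OF _ V])
    show "continuous_map S S (\<lambda>x. n \<otimes> x)"
      using that N top by (intro topological_group_mult[OF G]) (auto intro: subgroup.mem_carrier)
  qed
  ultimately show "openin (quotient_topology S (\<lambda>x. N #> x)) ((\<lambda>x. N #> x) ` V)"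
    using VG top by (auto simp: openin_quotient_topology)
qed

text \<open>The coset map is an open surjection, hence so is its square, which is therefore a
  quotient map. Continuity of the operations can then be checked before passing to cosets.\<close>

lemma topological_group_Mod:
  fixes G (structure)
  assumes G: "topological_group G S" and N: "N \<lhd> G"
  shows "topological_group (G Mod N) (quotient_topology S (\<lambda>x. N #> x))"
proof -
  interpret normal N G
    by (rule N)
  note top = topological_group_topspace[OF G]
  let ?q = "\<lambda>x. N #> x" and ?Q = "quotient_topology S (\<lambda>x. N #> x)"
  have q: "continuous_map S ?Q ?q"
    by (rule quotient_imp_continuous_map[OF quotient_map_quotient_topology])
  have q_open: "open_map S ?Q ?q"
    by (rule open_map_r_coset[OF G subgroup_axioms])
  let ?qq = "\<lambda>p. (?q (fst p), ?q (snd p))"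
  have "quotient_map (prod_topology S S) (prod_topology ?Q ?Q) ?qq"
  proof (rule continuous_open_imp_quotient_map)
    show "continuous_map (prod_topology S S) (prod_topology ?Q ?Q) ?qq"
      using continuous_map_compose[OF continuous_map_fst q] continuous_map_compose[OF continuous_map_snd q]
      by (intro continuous_map_pairedI) (simp_all add: o_def)
    show "?qq ` topspace (prod_topology S S) = topspace (prod_topology ?Q ?Q)"
      by force
  qed (rule open_map_prod[OF q_open q_open])
  moreover have "continuous_map (prod_topology S S) ?Q ((\<lambda>(x, y). x \<otimes>\<^bsub>G Mod N\<^esub> y) \<circ> ?qq)"
  proof (rule continuous_map_eq)
    show "continuous_map (prod_topology S S) ?Q (?q \<circ> (\<lambda>(x, y). x \<otimes> y))"
      using G q unfolding topological_group_def by (blast intro: continuous_map_compose)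
  qed (auto simp: top rcos_sum)
  ultimately have "continuous_map (prod_topology ?Q ?Q) ?Q (\<lambda>(x, y). x \<otimes>\<^bsub>G Mod N\<^esub> y)"
    by (rule continuous_compose_quotient_map)
  moreover have "continuous_map S ?Q ((\<lambda>x. inv\<^bsub>G Mod N\<^esub> x) \<circ> ?q)"
  proof (rule continuous_map_eq)
    show "continuous_map S ?Q (?q \<circ> (\<lambda>x. inv x))"
      using G q unfolding topological_group_def by (blast intro: continuous_map_compose)
  qed (auto simp: top inv_FactGroup rcos_inv carrier_FactGroup)
  then have "continuous_map ?Q ?Q (\<lambda>x. inv\<^bsub>G Mod N\<^esub> x)"
    by (rule continuous_compose_quotient_map[OF quotient_map_quotient_topology])
  ultimately show ?thesis
    using factorgroup_is_group top by (simp add: topological_group_def carrier_FactGroup)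
qed

text \<open>Distinct cosets of \<open>a\<close> and \<open>b\<close> mean that
  \<open>a \<otimes> inv b\<close> avoids the closed set \<open>N\<close>. This persists on a
  neighbourhood \<open>V \<times> W\<close> of \<open>(a, b)\<close>, so the open images of
  \<open>V\<close> and \<open>W\<close> are disjoint.\<close>

lemma Hausdorff_space_Mod:
  fixes G (structure)
  assumes G: "topological_group G S" and N: "subgroup N G" "closedin S N"
  shows "Hausdorff_space (quotient_topology S (\<lambda>x. N #> x))"
  unfolding Hausdorff_space_def
proof (intro allI impI, elim conjE)
  interpret group G
    by (rule topological_group_imp_group[OF G])
  note top = topological_group_topspace[OF G]
  let ?Q = "quotient_topology S (\<lambda>x. N #> x)"
  fix A B assume AB: "A \<in> topspace ?Q" "B \<in> topspace ?Q" "A \<noteq> B"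
  then obtain a b where ab: "a \<in> carrier G" "b \<in> carrier G" "A = N #> a" "B = N #> b"
    using top by auto
  have "continuous_map (prod_topology S S) S (\<lambda>p. fst p \<otimes> inv (snd p))"
    by (intro topological_group_mult[OF G] topological_group_inv[OF G] continuous_map_fst continuous_map_snd)
  then have "openin (prod_topology S S) {p \<in> topspace (prod_topology S S). fst p \<otimes> inv (snd p) \<in> topspace S - N}"
    using N(2) by (intro openin_continuous_map_preimage) auto
  moreover have "(a, b) \<in> {p \<in> topspace (prod_topology S S). fst p \<otimes> inv (snd p) \<in> topspace S - N}"
    using ab AB(3) top r_coset_eq_iff[OF N(1)] by simp
  ultimately obtain V W where VW: "openin S V" "openin S W" "a \<in> V" "b \<in> W"
    and sub: "V \<times> W \<subseteq> {p \<in> topspace (prod_topology S S). fst p \<otimes> inv (snd p) \<in> topspace S - N}"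
    by (rule openin_prod_topologyE)
  have "disjnt ((\<lambda>x. N #> x) ` V) ((\<lambda>x. N #> x) ` W)"
    unfolding disjnt_iff
  proof (intro allI notI, elim conjE imageE)
    fix C v w assume "C = N #> v" "v \<in> V" "C = N #> w" "w \<in> W"
    moreover from this have "(v, w) \<in> topspace (prod_topology S S)" "v \<otimes> inv w \<notin> N"
      using sub by auto
    ultimately show False
      using top r_coset_eq_iff[OF N(1), of v w] by auto
  qed
  moreover have "openin ?Q ((\<lambda>x. N #> x) ` V)" "openin ?Q ((\<lambda>x. N #> x) ` W)"
    using open_map_r_coset[OF G N(1)] VW unfolding open_map_def by blast+
  ultimately show "\<exists>V W. openin ?Q V \<and> openin ?Q W \<and> A \<in> V \<and> B \<in> W \<and> disjnt V W"
    using VW ab by blast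
qed

section \<open>Hausdorff homomorphisms and h-completeness\<close>

lemma Hausdorff_imp_fibrewise_Hausdorff: "Hausdorff_space S \<Longrightarrow> fibrewise_Hausdorff S f"
  unfolding Hausdorff_space_def fibrewise_Hausdorff_def by blast

text \<open>Points of one fibre are separated by hypothesis, and points of different fibres by
  preimages of disjoint open sets of \<open>T\<close>.\<close>

lemma fibrewise_Hausdorff_imp_Hausdorff:
  assumes "fibrewise_Hausdorff S f" "continuous_map S T f" "Hausdorff_space T"
  shows "Hausdorff_space S"
  unfolding Hausdorff_space_def
proof (intro allI impI, elim conjE)
  fix x y assume xy: "x \<in> topspace S" "y \<in> topspace S" "x \<noteq> y"
  show "\<exists>U V. openin S U \<and> openin S V \<and> x \<in> U \<and> y \<in> V \<and> disjnt U V"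
  proof (cases "f x = f y")
    case True
    then show ?thesis
      using assms(1) xy unfolding fibrewise_Hausdorff_def by blast
  next
    case False
    have "f x \<in> topspace T" "f y \<in> topspace T"
      using assms(2) xy by (auto simp: continuous_map_def Pi_iff)
    then obtain U V where UV: "openin T U" "openin T V" "f x \<in> U" "f y \<in> V" "disjnt U V"
      using assms(3) False unfolding Hausdorff_space_def by metis
    let ?pre = "\<lambda>U. {z \<in> topspace S. f z \<in> U}"
    have "openin S (?pre U)" "openin S (?pre V)"
      using UV openin_continuous_map_preimage[OF assms(2)] by blast+
    then show ?thesis
      using UV xy by (intro exI[of _ "?pre U"] exI[of _ "?pre V"]) (auto simp: disjnt_iff)
  qed
qed

text \<open>Changes the type of the test groups: multiplying a group over \<open>'a\<close> by a
  one-point group gives an equivalent test group over \<open>'a \<times> 'b\<close>.\<close>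

lemma h_complete_fst:
  assumes "h_complete TYPE('a \<times> 'b) G S H T f"
  shows "h_complete TYPE('a) G S H T f"
  unfolding h_complete_def
proof (intro allI impI, elim conjE)
  fix K :: "'a monoid" and U h k
  assume K: "topological_group K U" and h: "continuous_hom G S K U h"
    and k: "continuous_hom K U H T k" and haus: "fibrewise_Hausdorff U k"
    and fac: "\<forall>x\<in>carrier G. f x = k (h x)"
  let ?e = "undefined :: 'b"
  let ?D = "discrete_topology {?e}"
  let ?K = "K \<times>\<times> singleton_group ?e" and ?U = "prod_topology U ?D"
  have "topological_group (singleton_group ?e) ?D"
    unfolding topological_group_def
    by (auto simp: singleton_group_def m_inv_def simp flip: prod_topology_discrete_topology
        intro: singleton_group[unfolded singleton_group_def])
  then have K': "topological_group ?K ?U"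
    by (intro topological_group_DirProd K)
  have h': "continuous_hom G S ?K ?U (\<lambda>x. (h x, ?e))"
    using h by (auto simp: continuous_hom_def hom_def Pi_iff continuous_map_paired singleton_group_def)
  have "k \<circ> fst \<in> hom ?K H"
    using k by (auto simp: continuous_hom_def hom_def Pi_iff)
  then have k': "continuous_hom ?K ?U H T (k \<circ> fst)"
    using k by (auto simp: continuous_hom_def intro: continuous_map_compose[OF continuous_map_fst])
  have haus': "fibrewise_Hausdorff ?U (k \<circ> fst)"
    unfolding fibrewise_Hausdorff_def
  proof (intro ballI impI, elim conjE)
    fix x y assume xy: "x \<in> topspace ?U" "y \<in> topspace ?U" "x \<noteq> y" "(k \<circ> fst) x = (k \<circ> fst) y"
    then have "fst x \<noteq> fst y" "fst x \<in> topspace U" "fst y \<in> topspace U"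
      by (auto simp: prod_eq_iff)
    then obtain V W where VW: "openin U V" "openin U W" "fst x \<in> V" "fst y \<in> W" "disjnt V W"
      using haus xy(4) unfolding fibrewise_Hausdorff_def o_def by meson
    then show "\<exists>V W. openin ?U V \<and> openin ?U W \<and> x \<in> V \<and> y \<in> W \<and> disjnt V W"
      using xy by (intro exI[of _ "V \<times> {?e}"] exI[of _ "W \<times> {?e}"])
        (auto simp: openin_prod_Times_iff disjnt_iff)
  qed
  have "\<forall>x\<in>carrier G. f x = (k \<circ> fst) (h x, ?e)"
    using fac by simp
  then have "closedin ?U ((\<lambda>x. (h x, ?e)) ` carrier G)"
    using assms K' h' k' haus' unfolding h_complete_def by blast
  moreover have "(\<lambda>x. (h x, ?e)) ` carrier G = h ` carrier G \<times> {?e}"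
    by auto
  ultimately show "closedin U (h ` carrier G)"
    by (auto simp: closedin_prod_Times_iff)
qed

text \<open>As \<open>k\<close> is trivial on \<open>N\<close>, it factors through
  \<open>M Mod N\<close>, which is Hausdorff because \<open>N\<close> is closed. So h-completeness
  makes the image of \<open>G\<close> in the quotient closed, and the set in question is its
  preimage. The test group consists of cosets, whence the type \<open>'k set\<close>.\<close>

lemma h_complete_closedin_cosets:
  fixes M :: "'k monoid" (structure)
  assumes f: "h_complete TYPE('k set) G S H T f"
    and M: "topological_group M U" and H: "group H" and N: "N \<lhd> M" "closedin U N"
    and h: "continuous_hom G S M U h" and k: "continuous_hom M U H T k"
    and kN: "\<And>n. n \<in> N \<Longrightarrow> k n = \<one>\<^bsub>H\<^esub>" and fac: "\<And>x. x \<in> carrier G \<Longrightarrow> f x = k (h x)"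
  shows "closedin U {z \<in> carrier M. \<exists>x\<in>carrier G. \<exists>n\<in>N. z = n \<otimes> h x}"
proof -
  interpret normal N M
    by (rule N)
  interpret H: group H
    by (rule H)
  note top = topological_group_topspace[OF M]
  let ?q = "\<lambda>x. N #> x" and ?Q = "quotient_topology U (\<lambda>x. N #> x)"
  have k_hom: "k \<in> hom M H" and k_cont: "continuous_map U T k"
    and h_hom: "h ` carrier G \<subseteq> carrier M" "h \<in> hom G M" and h_cont: "continuous_map S U h"
    using h k by (auto simp: continuous_hom_def hom_def)
  \<comment> \<open>The choice is harmless: two elements of a coset differ by a left factor in
    \<open>N\<close>, where \<open>k\<close> is trivial.\<close>
  define k' where "k' C = k (SOME z. z \<in> C)" for C
  have k'q: "k' (N #> z) = k z" if z: "z \<in> carrier M" for z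
  proof -
    have "(SOME w. w \<in> N #> z) \<in> N #> z"
      using rcos_self[OF z subgroup_axioms] by (rule someI)
    then obtain n where n: "n \<in> N" "(SOME w. w \<in> N #> z) = n \<otimes> z"
      by (auto simp: r_coset_def)
    then have "k (n \<otimes> z) = k n \<otimes>\<^bsub>H\<^esub> k z"
      using z by (intro hom_mult[OF k_hom]) auto
    then show ?thesis
      using n kN hom_in_carrier[OF k_hom z] by (simp add: k'_def)
  qed
  have q: "continuous_map U ?Q ?q"
    by (rule quotient_imp_continuous_map[OF quotient_map_quotient_topology])
  have "continuous_hom G S (M Mod N) ?Q (?q \<circ> h)"
    using Group.hom_compose[OF h_hom(2) r_coset_hom_Mod] continuous_map_compose[OF h_cont q]
    by (simp add: continuous_hom_def)
  moreover have "continuous_hom (M Mod N) ?Q H T k'"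
    unfolding continuous_hom_def
  proof
    show "k' \<in> hom (M Mod N) H"
      using hom_in_carrier[OF k_hom] hom_mult[OF k_hom]
      by (auto intro!: homI simp: carrier_FactGroup k'q rcos_sum)
    have "continuous_map U T (k' \<circ> ?q)"
      by (rule continuous_map_eq[OF k_cont]) (simp add: top k'q)
    then show "continuous_map ?Q T k'"
      by (rule continuous_compose_quotient_map[OF quotient_map_quotient_topology])
  qed
  moreover have "fibrewise_Hausdorff ?Q k'"
    by (intro Hausdorff_imp_fibrewise_Hausdorff Hausdorff_space_Mod M N(2) subgroup_axioms)
  moreover have "\<forall>x\<in>carrier G. f x = k' ((?q \<circ> h) x)"
    using fac h_hom k'q by auto
  ultimately have "closedin ?Q ((?q \<circ> h) ` carrier G)"
    using f topological_group_Mod[OF M N(1)] unfolding h_complete_def by blast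
  then have "closedin U {z \<in> topspace U. ?q z \<in> (?q \<circ> h) ` carrier G}"
    by (rule closedin_continuous_map_preimage[OF q])
  also have "{z \<in> topspace U. ?q z \<in> (?q \<circ> h) ` carrier G} =
      {z \<in> carrier M. \<exists>x\<in>carrier G. \<exists>n\<in>N. z = n \<otimes> h x}"
  proof -
    have "N #> z = N #> h x \<longleftrightarrow> (\<exists>n\<in>N. z = n \<otimes> h x)" if "z \<in> carrier M" "x \<in> carrier G" for z x
    proof -
      have hx: "h x \<in> carrier M"
        using h_hom that by auto
      have "N #> z = N #> h x \<longleftrightarrow> z \<in> N #> h x"
        using repr_independence[OF _ hx subgroup_axioms, of z] rcos_self[OF that(1) subgroup_axioms] by metis
      then show ?thesis
        by (auto simp: r_coset_def)
    qed
    then show ?thesis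
      by (auto simp: top)
  qed
  finally show ?thesis .
qed

lemma conjugation_closure_of:
  fixes K (structure)
  assumes K: "topological_group K U"
    and conj: "\<And>a b. a \<in> A \<Longrightarrow> b \<in> B \<Longrightarrow> a \<otimes> b \<otimes> inv a \<in> B"
    and "a \<in> U closure_of A" "b \<in> U closure_of B"
  shows "a \<otimes> b \<otimes> inv a \<in> U closure_of B"
proof -
  have "continuous_map (prod_topology U U) U (\<lambda>p. fst p \<otimes> snd p \<otimes> inv (fst p))"
    by (intro topological_group_mult[OF K] topological_group_inv[OF K] continuous_map_fst continuous_map_snd)
  from continuous_map_closure2[OF this, of A B B a b] show ?thesis
    using assms by simp
qed

lemma right_mult_closure_of:
  fixes K (structure)
  assumes K: "topological_group K U" and c: "c \<in> carrier K"
    and AB: "\<And>a. a \<in> A \<Longrightarrow> a \<otimes> c \<in> B" and a: "a \<in> U closure_of A"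
  shows "a \<otimes> c \<in> U closure_of B"
proof -
  have "continuous_map U U (\<lambda>x. x \<otimes> c)"
    using c topological_group_topspace[OF K] by (intro topological_group_mult[OF K]) auto
  moreover have "(\<lambda>x. x \<otimes> c) ` A \<subseteq> B"
    using AB by auto
  ultimately show ?thesis
    using continuous_map_image_closure_subset[of U U "\<lambda>x. x \<otimes> c" A] closure_of_mono a by blast
qed

section \<open>Products of h-complete homomorphisms\<close>

lemma h_complete_product:
  fixes I :: "'i set"
    and G :: "'i \<Rightarrow> 'g monoid" and S :: "'i \<Rightarrow> 'g topology"
    and H :: "'i \<Rightarrow> 'h monoid" and T :: "'i \<Rightarrow> 'h topology"
    and f :: "'i \<Rightarrow> 'g \<Rightarrow> 'h"
  assumes G: "\<And>i. i \<in> I \<Longrightarrow> topological_group (G i) (S i)"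
    and H: "\<And>i. i \<in> I \<Longrightarrow> topological_group (H i) (T i)"
    and T: "\<And>i. i \<in> I \<Longrightarrow> Hausdorff_space (T i)"
    and f: "\<And>i. i \<in> I \<Longrightarrow> continuous_hom (G i) (S i) (H i) (T i) (f i)"
    and complete: "\<And>i. i \<in> I \<Longrightarrow> h_complete TYPE('k set) (G i) (S i) (H i) (T i) (f i)"
  shows "h_complete TYPE('k) (product_group I G) (product_topology S I)
          (product_group I H) (product_topology T I) (product_map I f)"
  unfolding h_complete_def
proof (intro allI impI, elim conjE)
  fix K :: "'k monoid" and U :: "'k topology"
    and h :: "('i \<Rightarrow> 'g) \<Rightarrow> 'k" and k :: "'k \<Rightarrow> 'i \<Rightarrow> 'h"
  let ?P = "product_group I G" and ?S = "product_topology S I"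
  assume K: "topological_group K U" and h: "continuous_hom ?P ?S K U h"
    and k: "continuous_hom K U (product_group I H) (product_topology T I) k"
    and haus: "fibrewise_Hausdorff U k"
    and fac: "\<forall>x\<in>carrier ?P. product_map I f x = k (h x)"
  note grp = topological_group_imp_group[OF G] topological_group_imp_group[OF H]
  interpret K: group K
    by (rule topological_group_imp_group[OF K])
  interpret P: group ?P
    by (rule product_group) (rule grp)
  have top: "topspace ?S = carrier ?P" "topspace U = carrier K"
    by (rule topological_group_topspace, rule topological_group_product, erule G)
      (rule topological_group_topspace[OF K])
  have h_hom: "h \<in> hom ?P K" and h_cont: "continuous_map ?S U h"
    and k_hom: "k \<in> hom K (product_group I H)" and k_cont: "continuous_map U (product_topology T I) k"
    using h k by (auto simp: continuous_hom_def)
  interpret h: group_hom ?P K h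
    by unfold_locales (rule h_hom)
  \<comment> \<open>\<open>k\<close> is Hausdorff over a Hausdorff product. Points of
    \<open>K\<close> are therefore closed, which at the end turns a limit into a value of
    \<open>h\<close>.\<close>
  have "Hausdorff_space U"
    by (rule fibrewise_Hausdorff_imp_Hausdorff[OF haus k_cont])
      (simp add: Hausdorff_space_product_topology T)

  \<comment> \<open>\<open>E J e\<close> is the subgroup of elements trivial on \<open>J\<close>,
    with \<open>e\<close> the identity, and \<open>E J x\<close> is its right coset through
    \<open>x\<close>. Accordingly \<open>C J x\<close> is the translate of \<open>C J e\<close> by
    \<open>h x\<close>.\<close>
  define E where "E J x = {u \<in> carrier ?P. \<forall>j\<in>J. u j = x j}" for J x
  define C where "C J x = U closure_of (h ` E J x)" for J x
  define e where "e = \<one>\<^bsub>?P\<^esub>"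
  have e: "e \<in> carrier ?P" "\<And>i. i \<in> I \<Longrightarrow> e i = \<one>\<^bsub>G i\<^esub>"
    unfolding e_def by (rule P.one_closed) simp
  have hE_C: "h ` E J x \<subseteq> C J x" for J x
    unfolding C_def
    by (rule closure_of_subset) (use h.hom_closed top(2) in \<open>auto simp: E_def\<close>)
  have C_closed: "closedin U (C J x)" for J x
    by (simp add: C_def)
  have E_subgroup: "subgroup (E J e) ?P" if "J \<subseteq> I" for J
  proof (rule P.subgroupI)
    show "E J e \<noteq> {}"
      using e by (auto simp: E_def)
    fix u assume u: "u \<in> E J e"
    then show "inv\<^bsub>?P\<^esub> u \<in> E J e"
      using that e(2) grp P.inv_closed[of u] by (auto simp: E_def subset_iff group.is_monoid monoid.inv_one)
    fix v assume "v \<in> E J e"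
    then show "u \<otimes>\<^bsub>?P\<^esub> v \<in> E J e"
      using u that e(2) grp P.m_closed[of u v] by (auto simp: E_def subset_iff group.is_monoid)
  qed (auto simp: E_def)
  have C_subgroup: "subgroup (C J e) K" if "J \<subseteq> I" for J
    unfolding C_def
    by (intro subgroup_closure_of[OF K] h.subgroup_img_is_subgroup E_subgroup that)
  have C_normal: "C J' e \<lhd> K\<lparr>carrier := C J e\<rparr>" if J: "J \<subseteq> J'" "J' \<subseteq> I" for J J'
  proof -
    have "J \<subseteq> I"
      using J by blast
    interpret M: group "K\<lparr>carrier := C J e\<rparr>"
      by (rule K.subgroup_imp_group[OF C_subgroup[OF \<open>J \<subseteq> I\<close>]])
    have "C J' e \<subseteq> C J e"
      unfolding C_def using J by (intro closure_of_mono image_mono) (auto simp: E_def)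
    then have "subgroup (C J' e) (K\<lparr>carrier := C J e\<rparr>)"
      by (intro K.subgroup_incl C_subgroup J \<open>J \<subseteq> I\<close>)
    \<comment> \<open>\<open>h\<close> need not be surjective, so normality is obtained only inside
      closures of images: elements of \<open>E J e\<close> normalise \<open>E J' e\<close>, and
      continuity of conjugation carries this over to the closures.\<close>
    moreover have "x \<otimes>\<^bsub>K\<^esub> n \<otimes>\<^bsub>K\<^esub> inv\<^bsub>K\<^esub> x \<in> C J' e" if "x \<in> C J e" "n \<in> C J' e" for x n
      using that unfolding C_def
    proof (rule conjugation_closure_of[OF K, rotated])
      fix a b assume "a \<in> h ` E J e" "b \<in> h ` E J' e"
      then obtain u v where uv: "a = h u" "b = h v" "u \<in> E J e" "v \<in> E J' e"
        by blast
      then have c: "u \<in> carrier ?P" "v \<in> carrier ?P"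
        by (auto simp: E_def)
      have w: "u \<otimes>\<^bsub>?P\<^esub> v \<otimes>\<^bsub>?P\<^esub> inv\<^bsub>?P\<^esub> u \<in> carrier ?P"
        using c by (intro P.m_closed P.inv_closed)
      have "(u \<otimes>\<^bsub>?P\<^esub> v \<otimes>\<^bsub>?P\<^esub> inv\<^bsub>?P\<^esub> u) j = e j" if "j \<in> J'" for j
      proof -
        have j: "j \<in> I" "v j = \<one>\<^bsub>G j\<^esub>"
          using that J uv(4) e(2) by (auto simp: E_def subset_iff)
        interpret Gj: group "G j"
          by (rule grp(1)[OF j(1)])
        have "u j \<in> carrier (G j)"
          using c j by auto
        then show ?thesis
          using c j e(2) grp by simp
      qed
      then have "u \<otimes>\<^bsub>?P\<^esub> v \<otimes>\<^bsub>?P\<^esub> inv\<^bsub>?P\<^esub> u \<in> E J' e"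
        using w unfolding E_def by blast
      moreover have "h (u \<otimes>\<^bsub>?P\<^esub> v \<otimes>\<^bsub>?P\<^esub> inv\<^bsub>?P\<^esub> u) = a \<otimes>\<^bsub>K\<^esub> b \<otimes>\<^bsub>K\<^esub> inv\<^bsub>K\<^esub> a"
        using c P.m_closed[OF c] P.inv_closed[OF c(1)] unfolding uv
        by (simp only: h.hom_mult h.hom_inv)
      ultimately show "a \<otimes>\<^bsub>K\<^esub> b \<otimes>\<^bsub>K\<^esub> inv\<^bsub>K\<^esub> a \<in> h ` E J' e"
        by (metis imageI)
    qed
    ultimately show ?thesis
      using K.m_inv_consistent[OF C_subgroup[OF \<open>J \<subseteq> I\<close>]] by (simp add: M.normal_inv_iff)
  qed
  have E_shift: "u \<otimes>\<^bsub>?P\<^esub> x \<in> E J x" if "u \<in> E J e" "x \<in> carrier ?P" "J \<subseteq> I" for u x J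
  proof -
    have "(u \<otimes>\<^bsub>?P\<^esub> x) j = x j" if "j \<in> J" for j
    proof -
      have j: "j \<in> I" "u j = \<one>\<^bsub>G j\<^esub>"
        using that \<open>J \<subseteq> I\<close> \<open>u \<in> E J e\<close> e(2) by (auto simp: E_def subset_iff)
      interpret Gj: group "G j"
        by (rule grp(1)[OF j(1)])
      have "x j \<in> carrier (G j)"
        using j \<open>x \<in> carrier ?P\<close> by auto
      then show ?thesis
        using j by simp
    qed
    then show ?thesis
      using that P.m_closed[of u x] unfolding E_def by blast
  qed
  have E_unshift: "u \<otimes>\<^bsub>?P\<^esub> inv\<^bsub>?P\<^esub> x \<in> E J e" if "u \<in> E J x" "x \<in> carrier ?P" "J \<subseteq> I" for u x J
  proof -
    have "(u \<otimes>\<^bsub>?P\<^esub> inv\<^bsub>?P\<^esub> x) j = e j" if "j \<in> J" for j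
    proof -
      have j: "j \<in> I" "u j = x j"
        using that \<open>J \<subseteq> I\<close> \<open>u \<in> E J x\<close> by (auto simp: E_def)
      interpret Gj: group "G j"
        by (rule grp(1)[OF j(1)])
      have "x j \<in> carrier (G j)"
        using j \<open>x \<in> carrier ?P\<close> by auto
      then show ?thesis
        using j \<open>x \<in> carrier ?P\<close> e(2) grp by simp
    qed
    then show ?thesis
      using that P.m_closed[of u "inv\<^bsub>?P\<^esub> x"] P.inv_closed[of x] unfolding E_def by blast
  qed

  have step: "\<exists>t\<in>carrier (G i). y \<in> C (insert i J) (x(i := t))"
    if J: "J \<subseteq> I" "i \<in> I - J" and x: "x \<in> carrier ?P" and y: "y \<in> C J x" for J i x y
  proof -
    have i: "i \<in> I" "insert i J \<subseteq> I"
      using J by auto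
    interpret Gi: group "G i"
      by (rule grp(1)[OF i(1)])
    let ?M = "K\<lparr>carrier := C J e\<rparr>" and ?U = "subtopology U (C J e)" and ?N = "C (insert i J) e"
    \<comment> \<open>\<open>?h\<close> includes \<open>G i\<close> as the factor at
      \<open>i\<close> before applying \<open>h\<close>, and \<open>?k\<close> is the component of
      \<open>k\<close> at \<open>i\<close>; their composite is \<open>f i\<close>.\<close>
    let ?h = "\<lambda>t. h (e(i := t))" and ?k = "\<lambda>z. k z i"
    have yK: "y \<in> carrier K"
      using y top by (simp add: C_def in_closure_of)
    have hx: "h x \<in> carrier K"
      by (rule h.hom_closed[OF x])
    have ei: "e(i := t) \<in> E J e" if "t \<in> carrier (G i)" for t
      using that e(1) i J by (auto simp: E_def PiE_iff extensional_def)
    have "y \<otimes>\<^bsub>K\<^esub> inv\<^bsub>K\<^esub> h x \<in> C J e"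
      using y unfolding C_def
    proof (rule right_mult_closure_of[OF K, rotated 2])
      fix a assume "a \<in> h ` E J x"
      then obtain u where u: "a = h u" "u \<in> E J x"
        by blast
      then have "h (u \<otimes>\<^bsub>?P\<^esub> inv\<^bsub>?P\<^esub> x) = a \<otimes>\<^bsub>K\<^esub> inv\<^bsub>K\<^esub> h x"
        using P.inv_closed[OF x] x by (simp only: E_def mem_Collect_eq h.hom_mult h.hom_inv)
      then show "a \<otimes>\<^bsub>K\<^esub> inv\<^bsub>K\<^esub> h x \<in> h ` E J e"
        using E_unshift[OF u(2) x J(1)] by (metis imageI)
    qed (rule K.inv_closed[OF hx])
    moreover have "C J e \<subseteq> {z \<in> C J e. \<exists>t\<in>carrier (G i). \<exists>n\<in>?N. z = n \<otimes>\<^bsub>K\<^esub> ?h t}"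
      (is "_ \<subseteq> ?D")
    proof -
      have M: "topological_group ?M ?U"
        by (rule topological_group_subgroup[OF K C_subgroup[OF J(1)]])
      have "?h \<in> hom (G i) ?M"
      proof (rule homI)
        show "?h t \<in> carrier ?M" if "t \<in> carrier (G i)" for t
          using ei[OF that] hE_C by (simp add: image_subset_iff)
        fix s t assume st: "s \<in> carrier (G i)" "t \<in> carrier (G i)"
        have "e(i := s \<otimes>\<^bsub>G i\<^esub> t) = e(i := s) \<otimes>\<^bsub>?P\<^esub> e(i := t)"
        proof
          fix j
          show "(e(i := s \<otimes>\<^bsub>G i\<^esub> t)) j = (e(i := s) \<otimes>\<^bsub>?P\<^esub> e(i := t)) j"
            using e grp(1) i by (cases "j \<in> I") (auto simp: group.is_monoid PiE_iff extensional_def)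
        qed
        moreover have "e(i := s) \<in> carrier ?P" "e(i := t) \<in> carrier ?P"
          using ei st unfolding E_def by blast+
        ultimately show "?h (s \<otimes>\<^bsub>G i\<^esub> t) = ?h s \<otimes>\<^bsub>?M\<^esub> ?h t"
          by (simp only: h.hom_mult) simp
      qed
      moreover have "continuous_map (S i) ?U ?h"
      proof (rule continuous_map_into_subtopology)
        have "continuous_map (S i) ?S (\<lambda>t. e(i := t))"
          unfolding continuous_map_componentwise
        proof (intro conjI ballI)
          show "(\<lambda>t. e(i := t)) ` topspace (S i) \<subseteq> extensional I"
            using e(1) i by (auto simp: PiE_iff extensional_def)
          show "continuous_map (S i) (S j) (\<lambda>t. (e(i := t)) j)" if "j \<in> I" for j
            using e(1) that topological_group_topspace[OF G] by (cases "j = i") (auto simp: PiE_iff)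
        qed
        then show "continuous_map (S i) U ?h"
          using continuous_map_compose[OF _ h_cont] by (fastforce simp: o_def)
        show "?h \<in> topspace (S i) \<rightarrow> C J e"
          unfolding topological_group_topspace[OF G[OF i(1)]] using ei hE_C by blast
      qed
      ultimately have h': "continuous_hom (G i) (S i) ?M ?U ?h"
        by (simp add: continuous_hom_def)
      have ki: "?k \<in> hom K (H i)" "continuous_map U (T i) ?k"
        using hom_compose[OF k_hom coordinate_hom[OF i(1)]] k_cont i(1)
        by (simp_all add: o_def continuous_map_componentwise)
      then have "?k \<in> hom ?M (H i)"
        using subgroup.subset[OF C_subgroup[OF J(1)]] by (auto simp: hom_def Pi_iff)
      then have k': "continuous_hom ?M ?U (H i) (T i) ?k"
        using ki(2) by (simp add: continuous_hom_def continuous_map_from_subtopology)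
      have fi: "f i (u i) = k (h u) i" if "u \<in> carrier ?P" for u
        using fac that i(1) by (metis product_map_def restrict_apply')
      have "f i \<in> hom (G i) (H i)"
        using f[OF i(1)] by (simp add: continuous_hom_def)
      then have f1: "f i \<one>\<^bsub>G i\<^esub> = \<one>\<^bsub>H i\<^esub>"
        by (rule hom_one[OF _ grp(1)[OF i(1)] grp(2)[OF i(1)]])
      \<comment> \<open>On images of elements trivial at \<open>i\<close> this component is
        \<open>f i\<close> of the identity. Since \<open>T i\<close> is Hausdorff, the equation with
        the constant map passes to the closure.\<close>
      have kN: "?k n = \<one>\<^bsub>H i\<^esub>" if "n \<in> ?N" for n
      proof (rule forall_in_closure_of_eq[where f = ?k and g = "\<lambda>_. \<one>\<^bsub>H i\<^esub>"])
        show "n \<in> U closure_of (h ` E (insert i J) e)"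
          using that by (simp add: C_def)
        show "continuous_map U (T i) (\<lambda>_. \<one>\<^bsub>H i\<^esub>)"
          using topological_group_topspace[OF H[OF i(1)]] grp(2)[OF i(1)] by (simp add: group.is_monoid)
        show "k z i = \<one>\<^bsub>H i\<^esub>" if z: "z \<in> h ` E (insert i J) e" for z
        proof -
          obtain u where "z = h u" "u \<in> carrier ?P" "u i = e i"
            using z unfolding E_def by blast
          then show ?thesis
            using fi[of u] f1 e(2)[OF i(1)] by simp
        qed
      qed (use T[OF i(1)] ki(2) in auto)
      have "closedin ?U {z \<in> carrier ?M. \<exists>t\<in>carrier (G i). \<exists>n\<in>?N. z = n \<otimes>\<^bsub>?M\<^esub> ?h t}"
      proof (rule h_complete_closedin_cosets[OF complete[OF i(1)] M grp(2)[OF i(1)] _ _ h' k' kN])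
        show "?N \<lhd> ?M"
          by (rule C_normal) (use i in auto)
        have "?N \<subseteq> C J e"
          unfolding C_def by (intro closure_of_mono image_mono) (auto simp: E_def)
        then show "closedin ?U ?N"
          using C_closed closedin_subset_topspace by blast
        show "f i t = k (h (e(i := t))) i" if "t \<in> carrier (G i)" for t
          using fi[of "e(i := t)"] ei[OF that] unfolding E_def by simp
      qed
      then have "closedin U ?D"
        using closedin_trans_full[OF _ C_closed] by simp
      \<comment> \<open>Splitting off the factor at \<open>i\<close> writes \<open>u\<close> as an
        element trivial on \<open>insert i J\<close> times \<open>e(i := u i)\<close>. Since
        \<open>?D\<close> is closed, it then contains all of \<open>C J e\<close>.\<close>
      moreover have "h ` E J e \<subseteq> ?D"
      proof (clarify, intro conjI)
        fix u assume u: "u \<in> E J e"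
        then show "h u \<in> C J e"
          using hE_C by blast
        have uP: "u \<in> carrier ?P"
          using u unfolding E_def by blast
        then have ui: "u i \<in> carrier (G i)"
          using i by auto
        then have v: "e(i := u i) \<in> carrier ?P"
          using ei unfolding E_def by blast
        have "u \<in> E (insert i J) (e(i := u i))"
          using u J unfolding E_def by auto
        then have "u \<otimes>\<^bsub>?P\<^esub> inv\<^bsub>?P\<^esub> (e(i := u i)) \<in> E (insert i J) e"
          by (rule E_unshift[OF _ v i(2)])
        then have "h (u \<otimes>\<^bsub>?P\<^esub> inv\<^bsub>?P\<^esub> (e(i := u i))) \<in> ?N"
          using hE_C by blast
        moreover have "h u = h (u \<otimes>\<^bsub>?P\<^esub> inv\<^bsub>?P\<^esub> (e(i := u i))) \<otimes>\<^bsub>K\<^esub> h (e(i := u i))"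
        proof -
          have "u \<otimes>\<^bsub>?P\<^esub> inv\<^bsub>?P\<^esub> (e(i := u i)) \<otimes>\<^bsub>?P\<^esub> e(i := u i) = u"
            using P.inv_solve_right'[OF _ uP v] P.m_closed[OF uP P.inv_closed[OF v]] by metis
          then show ?thesis
            using h.hom_mult[OF P.m_closed[OF uP P.inv_closed[OF v]] v] by metis
        qed
        ultimately show "\<exists>t\<in>carrier (G i). \<exists>n\<in>?N. h u = n \<otimes>\<^bsub>K\<^esub> ?h t"
          using ui by blast
      qed
      ultimately show ?thesis
        unfolding C_def[of J e] by (intro closure_of_minimal) (simp_all add: C_def)
    qed
    ultimately obtain t n where t: "t \<in> carrier (G i)" and n: "n \<in> ?N"
      and eq: "y \<otimes>\<^bsub>K\<^esub> inv\<^bsub>K\<^esub> h x = n \<otimes>\<^bsub>K\<^esub> ?h t"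
      by blast
    have et: "e(i := t) \<in> carrier ?P"
      using ei[OF t] unfolding E_def by blast
    \<comment> \<open>The element \<open>y\<close> times the inverse of \<open>h x\<close> equals
      \<open>n\<close> times \<open>?h t\<close>. Moving \<open>h x\<close> back to the right
      multiplies the old coordinate by \<open>t\<close> on the left.\<close>
    let ?x = "x(i := t \<otimes>\<^bsub>G i\<^esub> x i)"
    have xi: "t \<otimes>\<^bsub>G i\<^esub> x i \<in> carrier (G i)"
      using t x i by auto
    then have x': "?x \<in> carrier ?P"
      using x i by (auto simp: PiE_iff extensional_def)
    have "e(i := t) \<otimes>\<^bsub>?P\<^esub> x = ?x"
    proof
      fix j
      show "(e(i := t) \<otimes>\<^bsub>?P\<^esub> x) j = ?x j"
        using e grp(1) i x by (cases "j \<in> I") (auto simp: group.is_monoid PiE_iff extensional_def)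
    qed
    then have hx': "?h t \<otimes>\<^bsub>K\<^esub> h x = h ?x"
      using h.hom_mult[OF et x] by simp
    have nK: "n \<in> carrier K" and hK: "?h t \<in> carrier K"
      using subgroup.mem_carrier[OF C_subgroup[OF i(2)] n] h.hom_closed[OF et] by auto
    have "y = y \<otimes>\<^bsub>K\<^esub> inv\<^bsub>K\<^esub> h x \<otimes>\<^bsub>K\<^esub> h x"
      using yK hx by (simp add: K.m_assoc)
    also have "\<dots> = n \<otimes>\<^bsub>K\<^esub> h ?x"
      unfolding eq using nK hK hx hx' by (simp add: K.m_assoc)
    also have "\<dots> \<in> C (insert i J) ?x"
      using n unfolding C_def
    proof (rule right_mult_closure_of[OF K, rotated 2])
      fix a assume "a \<in> h ` E (insert i J) e"
      then obtain u where u: "a = h u" "u \<in> E (insert i J) e"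
        by blast
      then have "h (u \<otimes>\<^bsub>?P\<^esub> ?x) = a \<otimes>\<^bsub>K\<^esub> h ?x"
        using x' h.hom_mult unfolding E_def by blast
      then show "a \<otimes>\<^bsub>K\<^esub> h ?x \<in> h ` E (insert i J) ?x"
        using E_shift[OF u(2) x' i(2)] by (metis imageI)
    qed (rule h.hom_closed[OF x'])
    finally show ?thesis
      using xi by blast
  qed

  \<comment> \<open>\<open>K\<close> itself has no coordinates, so the finite approximation is made
    in the product: \<open>h u\<close> is near \<open>y\<close> with \<open>u\<close> equal to
    \<open>x\<close> on a finite set, and a factor \<open>v\<close> near the identity corrects
    \<open>u\<close> on the rest of \<open>J\<close>.\<close>
  have limit: "y \<in> C J x"
    if J: "J \<subseteq> I" and x: "x \<in> carrier ?P"
      and fin: "\<And>F. finite F \<Longrightarrow> F \<subseteq> J \<Longrightarrow> \<exists>x'\<in>carrier ?P. (\<forall>j\<in>F. x' j = x j) \<and> y \<in> C F x'"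
    for J x y
    unfolding C_def in_closure_of
  proof (intro conjI allI impI; (elim conjE)?)
    show yU: "y \<in> topspace U"
      using fin[of "{}"] by (auto simp: C_def in_closure_of)
    fix W assume W: "y \<in> W" "openin U W"
    \<comment> \<open>Continuity at \<open>(y, e)\<close> determines how small the correction
      \<open>v\<close> must be before its finite set \<open>F\<close> of constrained indices is
      known and \<open>u\<close> is chosen.\<close>
    have "continuous_map (prod_topology U ?S) U (\<lambda>p. fst p \<otimes>\<^bsub>K\<^esub> h (snd p))"
      using continuous_map_compose[OF continuous_map_snd h_cont]
      by (intro topological_group_mult[OF K] continuous_map_fst) (simp add: o_def)
    then have "openin (prod_topology U ?S) {p \<in> topspace (prod_topology U ?S). fst p \<otimes>\<^bsub>K\<^esub> h (snd p) \<in> W}"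
      by (rule openin_continuous_map_preimage[OF _ W(2)])
    moreover have "(y, e) \<in> {p \<in> topspace (prod_topology U ?S). fst p \<otimes>\<^bsub>K\<^esub> h (snd p) \<in> W}"
      using yU e(1) W(1) top h.hom_one[folded e_def] by simp
    ultimately obtain V V' where V: "openin U V" "openin ?S V'" "y \<in> V" "e \<in> V'"
      and sub: "V \<times> V' \<subseteq> {p \<in> topspace (prod_topology U ?S). fst p \<otimes>\<^bsub>K\<^esub> h (snd p) \<in> W}"
      by (rule openin_prod_topologyE)
    obtain B where B: "finite {i\<in>I. B i \<noteq> topspace (S i)}" "\<forall>i\<in>I. openin (S i) (B i)"
        "e \<in> PiE I B" "PiE I B \<subseteq> V'"
      using V(2,4) by (rule openin_product_topologyE)
    define F where "F = {i\<in>J. B i \<noteq> topspace (S i)}"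
    have "finite F" "F \<subseteq> J"
      using J by (auto simp: F_def intro: finite_subset[OF _ B(1)])
    then obtain x' where x': "\<forall>j\<in>F. x' j = x j" "y \<in> C F x'"
      using fin by blast
    then have "\<exists>z. z \<in> h ` E F x' \<and> z \<in> V"
      using V unfolding C_def in_closure_of by blast
    then obtain u where u: "u \<in> carrier ?P" "\<forall>j\<in>F. u j = x j" "h u \<in> V"
      using x'(1) unfolding E_def by auto
    \<comment> \<open>Solves \<open>u \<otimes> v = x\<close> on \<open>J\<close>. On
      \<open>F\<close> the solution is trivial because \<open>u\<close> equals \<open>x\<close>
      there, and at the other indices of \<open>J\<close> the neighbourhood \<open>B\<close> imposes
      no restriction.\<close>
    define v where "v = (\<lambda>i\<in>I. if i \<in> J then inv\<^bsub>G i\<^esub> u i \<otimes>\<^bsub>G i\<^esub> x i else \<one>\<^bsub>G i\<^esub>)"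
    have v: "v i \<in> carrier (G i)" "i \<in> J \<Longrightarrow> u i \<otimes>\<^bsub>G i\<^esub> v i = x i" "i \<in> J \<Longrightarrow> u i = x i \<Longrightarrow> v i = e i"
        "i \<notin> J \<Longrightarrow> v i = e i" if "i \<in> I" for i
    proof -
      interpret Gi: group "G i"
        by (rule grp(1)[OF that])
      have "u i \<in> carrier (G i)" "x i \<in> carrier (G i)"
        using u x that by auto
      then show "v i \<in> carrier (G i)" "i \<in> J \<Longrightarrow> u i \<otimes>\<^bsub>G i\<^esub> v i = x i"
          "i \<in> J \<Longrightarrow> u i = x i \<Longrightarrow> v i = e i" "i \<notin> J \<Longrightarrow> v i = e i"
        using that e(2) by (simp_all add: v_def flip: Gi.m_assoc)
    qed
    have vP: "v \<in> carrier ?P"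
      using v(1) by (simp add: PiE_iff) (simp add: v_def)
    have "v \<in> PiE I B"
    proof (rule PiE_I)
      fix i assume i: "i \<in> I"
      have "e i \<in> B i"
        using B(3) i by auto
      moreover have "v i \<in> topspace (S i)"
        using v(1) i topological_group_topspace[OF G] by auto
      ultimately show "v i \<in> B i"
        using v(3,4)[OF i] u(2) by (cases "i \<in> J"; cases "B i = topspace (S i)") (auto simp: F_def)
    qed (simp add: v_def)
    then have "(h u, v) \<in> V \<times> V'"
      using u(3) B(4) by blast
    then have "h u \<otimes>\<^bsub>K\<^esub> h v \<in> W"
      using subsetD[OF sub] by fastforce
    then have "h (u \<otimes>\<^bsub>?P\<^esub> v) \<in> W"
      using h.hom_mult[OF u(1) vP] by simp
    moreover have "u \<otimes>\<^bsub>?P\<^esub> v \<in> E J x"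
      using P.m_closed[OF u(1) vP] v(2) J unfolding E_def by (auto simp: subset_iff)
    ultimately show "\<exists>z. z \<in> h ` E J x \<and> z \<in> W"
      by (intro exI[of _ "h (u \<otimes>\<^bsub>?P\<^esub> v)"] conjI imageI)
  qed

  have "y \<in> h ` carrier ?P" if y: "y \<in> U closure_of (h ` carrier ?P)" for y
  proof -
    have "\<exists>x\<in>\<Pi>\<^sub>E i\<in>I. carrier (G i). y \<in> C I x"
    proof (rule finite_character_selection)
      show "e \<in> (\<Pi>\<^sub>E i\<in>I. carrier (G i))"
        using e(1) by simp
      show "y \<in> C {} e"
        using y by (simp add: C_def E_def)
      show "y \<in> C F x" if "y \<in> C J x" "F \<subseteq> J" for J F x
      proof -
        have "C J x \<subseteq> C F x"
          unfolding C_def using \<open>F \<subseteq> J\<close> by (intro closure_of_mono image_mono) (auto simp: E_def)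
        then show ?thesis
          using that by blast
      qed
    next
      fix J x i assume "J \<subseteq> I" "x \<in> (\<Pi>\<^sub>E i\<in>I. carrier (G i))" "y \<in> C J x" "i \<in> I - J"
      then show "\<exists>t\<in>carrier (G i). y \<in> C (insert i J) (x(i := t))"
        using step[unfolded carrier_product_group] by blast
    qed (rule limit[unfolded carrier_product_group])
    then obtain x where x: "x \<in> carrier ?P" "y \<in> C I x"
      by auto
    \<comment> \<open>Once all coordinates are fixed, \<open>C I x\<close> is the closure of the
      single point \<open>h x\<close>, which is closed.\<close>
    have "E I x = {x}"
      using x(1) unfolding E_def by (auto intro: PiE_ext)
    then have "y \<in> U closure_of {h x}"
      using x(2) by (simp add: C_def)
    moreover have "closedin U {h x}"
      using closedin_Hausdorff_singleton[OF \<open>Hausdorff_space U\<close>] h.hom_closed[OF x(1)] top(2) by simp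
    ultimately show ?thesis
      using x(1) by (simp add: closure_of_closedin)
  qed
  moreover have "h ` carrier ?P \<subseteq> topspace U"
    using top h.hom_closed by blast
  ultimately show "closedin U (h ` carrier ?P)"
    using closure_of_subset_eq by blast
qed

(* The type 'k of the test groups in the conclusions is an arbitrary type variable, so the
   conclusions hold for test groups of every type. The hypotheses are required only for test
   groups in one type built from 'i, 'g, 'h and 'k, which is implied by c-properness
   (c-perfectness, h-completeness) with respect to all topological groups. *)
theorem theorem5p1:
  fixes I :: "'i set"
    and G :: "'i \<Rightarrow> 'g monoid" and S :: "'i \<Rightarrow> 'g topology"
    and H :: "'i \<Rightarrow> 'h monoid" and T :: "'i \<Rightarrow> 'h topology"
    and f :: "'i \<Rightarrow> 'g \<Rightarrow> 'h"
  assumes "\<And>i. i \<in> I \<Longrightarrow> topological_group (G i) (S i)"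
    and "\<And>i. i \<in> I \<Longrightarrow> topological_group (H i) (T i)"
    and "\<And>i. i \<in> I \<Longrightarrow> Hausdorff_space (T i)"
    and "\<And>i. i \<in> I \<Longrightarrow> continuous_hom (G i) (S i) (H i) (T i) (f i)"
  shows
    "((\<forall>i\<in>I. c_proper TYPE(('i \<Rightarrow> 'g) \<times> 'k) (G i) (S i) (H i) (T i) (f i)) \<longrightarrow>
        c_proper TYPE('k) (product_group I G) (product_topology S I)
          (product_group I H) (product_topology T I) (product_map I f)) \<and>
     ((\<forall>i\<in>I. c_perfect TYPE(('i \<Rightarrow> 'g) \<times> 'k) (G i) (S i) (H i) (T i) (f i)) \<longrightarrow>
        c_perfect TYPE('k) (product_group I G) (product_topology S I)
          (product_group I H) (product_topology T I) (product_map I f)) \<and>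
     ((\<forall>i\<in>I. h_complete TYPE('k set \<times> 'h) (G i) (S i) (H i) (T i) (f i)) \<longrightarrow>
        h_complete TYPE('k) (product_group I G) (product_topology S I)
          (product_group I H) (product_topology T I) (product_map I f))"
proof (intro conjI impI)
  assume "\<forall>i\<in>I. c_proper TYPE(('i \<Rightarrow> 'g) \<times> 'k) (G i) (S i) (H i) (T i) (f i)"
  then show "c_proper TYPE('k) (product_group I G) (product_topology S I)
      (product_group I H) (product_topology T I) (product_map I f)"
    by (intro c_proper_product assms(1,2,4)) auto
next
  assume "\<forall>i\<in>I. c_perfect TYPE(('i \<Rightarrow> 'g) \<times> 'k) (G i) (S i) (H i) (T i) (f i)"
  then show "c_perfect TYPE('k) (product_group I G) (product_topology S I)
      (product_group I H) (product_topology T I) (product_map I f)"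
    unfolding c_perfect_def by (intro conjI c_proper_product fibrewise_Hausdorff_product assms(1,2,4)) auto
next
  assume "\<forall>i\<in>I. h_complete TYPE('k set \<times> 'h) (G i) (S i) (H i) (T i) (f i)"
  then have *: "h_complete TYPE('k set) (G i) (S i) (H i) (T i) (f i)" if "i \<in> I" for i
    by (rule h_complete_fst[OF bspec[OF _ that]])
  show "h_complete TYPE('k) (product_group I G) (product_topology S I)
      (product_group I H) (product_topology T I) (product_map I f)"
    by (intro h_complete_product assms *)
qed

end
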